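(* Let $\mathcal{C}=C(S^{k_1}\times\cdots\times S^{k_l})$ be a $k$-dimensional minimal cone over a product of spheres, where $k=1+\sum_{i=1}^l k_i$. Then $\mathcal{C}$ is $f$-stable for $f(x)=|x|^\alpha$ whenever $\alpha\ge-k+2\sqrt{2(k-1)}$. In particular, such a cone is $f$-stable if $\dim\mathcal{C}=k\ge7$ and $\alpha\ge4\sqrt3-7$.
   Context: Here $l\ge2$, $k_i\ge1$, and $C(S^{k_1}\times\cdots\times S^{k_l})$ denotes the cone $\{tx:t\ge0,\ x\in\Sigma\}$ over $\Sigma=S^{k_1}(r_1)\times\cdots\times S^{k_l}(r_l)\subset S^{n-1}(1)\subset\mathbb{R}^n$, with $n=\sum_i(k_i+1)$ and $r_i^2=k_i/(k-1)$, so that $\Sigma$ is minimal in the unit sphere. Stability is for the functional $\mathcal{E}_f(M)=\int_M f\,d\mathcal{H}_k$ ($\mathcal{H}_k$ is $k$-dimensional Hausdorff measure). Let $D$ be the flat connection of $\mathbb{R}^n$, let $(\cdot)^\perp$ be the normal projection, let $\mathbf{B}(X,Y)=(D_XY)^\perp$, let $e_1,\dots,e_k$ be a local orthonormal tangent frame, and let $\mathbf{H}=\sum_i\mathbf{B}(e_i,e_i)$. A $C^2$ submanifold $M$ is $f$-stationary in $U=\mathbb{R}^n\setminus\{0\}$ if the first variation of $\mathcal{E}_f$ vanishes for deformations compactly supported in $U$ (equivalently $f\mathbf{H}=(Df)^\perp$ on $M\cap U$; minimal cones satisfy this for radial $f$). It is then $f$-stable if for every $C^1$ normal vector field $X$ along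 $M$ with compact support in $M\cap U$, $$\int_M f\Big[\sum_{i,j=1}^k\langle\mathbf{B}(e_i,e_j),X\rangle^2+\langle\mathbf{H},X\rangle^2\Big]d\mathcal{H}_k\le\int_M \Big(f\sum_{i=1}^k|(D_{e_i}X)^\perp|^2+\mathrm{Hess} f(X,X)\Big)d\mathcal{H}_k .$$ For the cone $\mathcal{C}$ this is applied to its regular part $M=\mathcal{C}\setminus\{0\}$, i.e. with normal fields compactly supported away from the origin. *)

theory Defs
  imports "HOL-Analysis.Analysis"
begin

section \<open>Hausdorff measure\<close>

text \<open>The normalisation is the geometric one: \<open>\<omega>\<^sub>k (diam/2)\<^sup>k\<close>, with \<open>\<omega>\<^sub>k\<close> the volume of the
  Euclidean unit \<open>k\<close>-ball. The test for the empty set only matters for \<open>k = 0\<close> (where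
  \<open>0 ^ 0 = 1\<close>); boundedness is required since \<^const>\<open>diameter\<close> is unspecified on unbounded sets.\<close>

definition hausdorff_pre :: "nat \<Rightarrow> real \<Rightarrow> 'a::euclidean_space set \<Rightarrow> ennreal" where
  "hausdorff_pre k \<delta> A =
     (INF C \<in> {C :: nat \<Rightarrow> 'a set. A \<subseteq> (\<Union>i. C i) \<and> (\<forall>i. bounded (C i) \<and> diameter (C i) \<le> \<delta>)}.
        \<Sum>i. if C i = {} then 0 else ennreal (unit_ball_vol (real k) * (diameter (C i) / 2) ^ k))"

definition hausdorff_outer :: "nat \<Rightarrow> 'a::euclidean_space set \<Rightarrow> ennreal" where
  "hausdorff_outer k A = (SUP \<delta> \<in> {0<..}. hausdorff_pre k \<delta> A)"

text \<open>\<^const>\<open>hausdorff_outer\<close> is a metric outer measure, so by Caratheodory's criterion it is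
  countably additive on the Borel sets and \<^const>\<open>measure_of\<close> does not degenerate.\<close>

definition hausdorff_measure :: "nat \<Rightarrow> 'a::euclidean_space measure" where
  "hausdorff_measure k = measure_of UNIV (sets borel) (hausdorff_outer k)"


section \<open>Submanifolds of Euclidean space\<close>

definition C1_on :: "'a::euclidean_space set \<Rightarrow> ('a \<Rightarrow> 'b::real_normed_vector) \<Rightarrow> bool" where
  "C1_on W f \<longleftrightarrow> (\<exists>f' :: 'a \<Rightarrow> 'a \<Rightarrow>\<^sub>L 'b.
     (\<forall>x\<in>W. (f has_derivative blinfun_apply (f' x)) (at x)) \<and> continuous_on W f')"

definition C2_on :: "'a::euclidean_space set \<Rightarrow> ('a \<Rightarrow> 'b::real_normed_vector) \<Rightarrow> bool" where
  "C2_on W f \<longleftrightarrow> (\<exists>f' :: 'a \<Rightarrow> 'a \<Rightarrow>\<^sub>L 'b.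
     (\<forall>x\<in>W. (f has_derivative blinfun_apply (f' x)) (at x)) \<and> C1_on W f')"

text \<open>Embedded submanifold: around each point a \<open>C\<^sup>2\<close> diffeomorphism \<open>\<Phi>\<close> (with inverse \<open>\<Psi>\<close>)
  between open sets of the ambient space flattens \<open>M\<close> to a \<open>k\<close>-dimensional linear subspace.\<close>

definition C2_submanifold :: "nat \<Rightarrow> 'a::euclidean_space set \<Rightarrow> bool" where
  "C2_submanifold k M \<longleftrightarrow>
     (\<forall>p\<in>M. \<exists>W W' S (\<Phi> :: 'a \<Rightarrow> 'a) (\<Psi> :: 'a \<Rightarrow> 'a).
        open W \<and> p \<in> W \<and> open W' \<and> C2_on W \<Phi> \<and> C2_on W' \<Psi> \<and>
        \<Phi> ` W = W' \<and> \<Psi> ` W' = W \<and> (\<forall>x\<in>W. \<Psi> (\<Phi> x) = x) \<and> (\<forall>y\<in>W'. \<Phi> (\<Psi> y) = y) \<and>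
        subspace S \<and> dim S = k \<and> \<Phi> ` (M \<inter> W) = S \<inter> W')"

text \<open>Tangent vectors are the velocities of \<open>C\<^sup>1\<close> curves in \<open>M\<close>.\<close>

definition tan_space :: "'a::euclidean_space set \<Rightarrow> 'a \<Rightarrow> 'a set" where
  "tan_space M p = {v. \<exists>\<gamma> \<epsilon>. 0 < \<epsilon> \<and> \<gamma> C1_differentiable_on {-\<epsilon><..<\<epsilon>} \<and>
     \<gamma> ` {-\<epsilon><..<\<epsilon>} \<subseteq> M \<and> \<gamma> 0 = p \<and> (\<gamma> has_vector_derivative v) (at 0)}"

definition normal_space :: "'a::euclidean_space set \<Rightarrow> 'a \<Rightarrow> 'a set" where
  "normal_space M p = {w. \<forall>v \<in> tan_space M p. inner v w = 0}"

definition nproj :: "'a::euclidean_space set \<Rightarrow> 'a \<Rightarrow> 'a \<Rightarrow> 'a" where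
  "nproj M p v = (THE w. w \<in> normal_space M p \<and> v - w \<in> tan_space M p)"

text \<open>An orthonormal basis of the tangent space at \<open>p\<close>, as a set (of cardinality \<open>k\<close>). All
  expressions below in which it occurs are independent of the chosen basis.\<close>

definition tan_frame :: "'a::euclidean_space set \<Rightarrow> 'a \<Rightarrow> 'a set" where
  "tan_frame M p = (SOME E. pairwise orthogonal E \<and> (\<forall>e\<in>E. norm e = 1) \<and>
     E \<subseteq> tan_space M p \<and> span E = tan_space M p)"


section \<open>Vector fields and the second fundamental form\<close>

text \<open>A map on \<open>M\<close> is \<open>C\<^sup>1\<close> if it extends locally to a \<open>C\<^sup>1\<close> map on an open set.\<close>

definition C1_along :: "'a::euclidean_space set \<Rightarrow> ('a \<Rightarrow> 'a) \<Rightarrow> bool" where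
  "C1_along M Y \<longleftrightarrow>
     (\<forall>p\<in>M. \<exists>W Z. open W \<and> p \<in> W \<and> C1_on W Z \<and> (\<forall>x \<in> M \<inter> W. Y x = Z x))"

text \<open>\<open>flat_deriv M Y p u\<close> is \<open>D\<^sub>u Y\<close> at \<open>p\<close> for \<open>u\<close> tangent to \<open>M\<close>. The derivative within \<open>M\<close>
  is not unique as a linear map on the ambient space, but its values at tangent vectors are.\<close>

definition flat_deriv :: "'a::euclidean_space set \<Rightarrow> ('a \<Rightarrow> 'a) \<Rightarrow> 'a \<Rightarrow> 'a \<Rightarrow> 'a" where
  "flat_deriv M Y p u = (THE d. \<exists>L. (Y has_derivative L) (at p within M) \<and> d = L u)"

text \<open>\<open>\<^bold>B(u, v) = (D\<^sub>u V)\<^sup>\<bottom>\<close> for any local tangent field \<open>V\<close> with \<open>V p = v\<close>.\<close>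

definition sff :: "'a::euclidean_space set \<Rightarrow> 'a \<Rightarrow> 'a \<Rightarrow> 'a \<Rightarrow> 'a" where
  "sff M p u v = (THE b. \<exists>V W. open W \<and> p \<in> W \<and> C1_along (M \<inter> W) V \<and>
     (\<forall>x \<in> M \<inter> W. V x \<in> tan_space M x) \<and> V p = v \<and>
     b = nproj M p (flat_deriv M V p u))"

definition mean_curv :: "'a::euclidean_space set \<Rightarrow> 'a \<Rightarrow> 'a" where
  "mean_curv M p = (\<Sum>e \<in> tan_frame M p. sff M p e e)"

definition grad :: "('a::euclidean_space \<Rightarrow> real) \<Rightarrow> 'a \<Rightarrow> 'a" where
  "grad f p = (THE g. GDERIV f p :> g)"

definition hess :: "('a::euclidean_space \<Rightarrow> real) \<Rightarrow> 'a \<Rightarrow> 'a \<Rightarrow> 'a \<Rightarrow> real" where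
  "hess f p u v = frechet_derivative (\<lambda>x. frechet_derivative f (at x) v) (at p) u"

definition normal_field_cs :: "'a::euclidean_space set \<Rightarrow> ('a \<Rightarrow> 'a) \<Rightarrow> bool" where
  "normal_field_cs M X \<longleftrightarrow>
     C1_along M X \<and> (\<forall>p\<in>M. X p \<in> normal_space M p) \<and>
     (\<exists>K. compact K \<and> K \<subseteq> M \<and> (\<forall>p \<in> M - K. X p = 0))"


section \<open>Stationarity and stability for the weighted area functional\<close>

text \<open>The Euler--Lagrange equation \<open>f \<^bold>H = (Df)\<^sup>\<bottom>\<close> of \<open>M \<mapsto> \<integral>\<^sub>M f d\<H>\<^sub>k\<close> in the open set \<open>U\<close>.\<close>

definition f_stationary :: "('a::euclidean_space \<Rightarrow> real) \<Rightarrow> 'a set \<Rightarrow> 'a set \<Rightarrow> bool" where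
  "f_stationary f U M \<longleftrightarrow> (\<forall>p \<in> M \<inter> U. f p *\<^sub>R mean_curv M p = nproj M p (grad f p))"

text \<open>A field on \<open>M\<close> with compact support in \<open>M \<inter> U\<close> is the same as one on \<open>M \<inter> U\<close> with compact
  support, extended by \<open>0\<close>.\<close>

definition f_stable :: "nat \<Rightarrow> ('a::euclidean_space \<Rightarrow> real) \<Rightarrow> 'a set \<Rightarrow> 'a set \<Rightarrow> bool" where
  "f_stable k f U M \<longleftrightarrow>
     C2_submanifold k (M \<inter> U) \<and> f_stationary f U M \<and>
     (\<forall>X. normal_field_cs (M \<inter> U) X \<longrightarrow>
        (LINT p : M \<inter> U | hausdorff_measure k.
           f p * ((\<Sum>u \<in> tan_frame M p. \<Sum>v \<in> tan_frame M p. (inner (sff M p u v) (X p))\<^sup>2)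
                  + (inner (mean_curv M p) (X p))\<^sup>2))
        \<le> (LINT p : M \<inter> U | hausdorff_measure k.
             f p * (\<Sum>u \<in> tan_frame M p. (norm (nproj M p (flat_deriv M X p u)))\<^sup>2)
             + hess f p (X p) (X p)))"


section \<open>Cones over products of spheres\<close>

text \<open>\<open>blk\<close> assigns each coordinate to one of the blocks \<open>1, \<dots>, l\<close>, which identifies the ambient
  space with the product of the block spaces; \<open>r i\<close> is the radius of the sphere in block \<open>i\<close>.\<close>

definition sphere_product ::
    "nat \<Rightarrow> ('n::finite \<Rightarrow> nat) \<Rightarrow> (nat \<Rightarrow> real) \<Rightarrow> (real ^ 'n) set" where
  "sphere_product l blk r = {x. \<forall>i\<in>{1..l}. L2_set (\<lambda>a. x $ a) {a. blk a = i} = r i}"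

definition cone_over :: "'a::real_vector set \<Rightarrow> 'a set" where
  "cone_over \<Sigma> = {t *\<^sub>R x | t x. 0 \<le> t \<and> x \<in> \<Sigma>}"

text \<open>The radii \<open>r\<^sub>i\<^sup>2 = k\<^sub>i / (k - 1)\<close>, for which the product is minimal in the unit sphere;
  \<open>k - 1\<close> is the sum of all \<open>k\<^sub>i\<close>.\<close>

definition minimal_radius :: "nat \<Rightarrow> (nat \<Rightarrow> nat) \<Rightarrow> nat \<Rightarrow> real" where
  "minimal_radius l ks i = sqrt (real (ks i) / real (\<Sum>j=1..l. ks j))"

end

theory Submission
  imports Defs
begin

text \<open>
  At a point \<open>p\<close> of the cone with blocks \<open>p\<^sub>i\<close>, the normal vectors are \<open>X = (c\<^sub>i p\<^sub>i)\<close> with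
  \<open>\<Sum> c\<^sub>i \<rho>\<^sub>i = 0\<close>, where \<open>\<rho>\<^sub>i = k\<^sub>i / (k - 1)\<close>, and \<open>\<langle>\<^bold>B(u, v), X\<rangle> = - \<Sum> c\<^sub>i \<langle>u\<^sub>i, v\<^sub>i\<rangle>\<close>. Taking traces
  gives \<open>\<^bold>H = 0\<close> and \<open>\<Sum> \<langle>\<^bold>B(e\<^sub>i, e\<^sub>j), X\<rangle>\<^sup>2 = (k - 1) |X|\<^sup>2 / |p|\<^sup>2\<close>, while \<open>Hess f(X, X) = \<alpha> |p|\<^bsup>\<alpha>-2\<^esup> |X|\<^sup>2\<close>
  because \<open>X\<close> is orthogonal to \<open>p\<close>. Stability thus follows from the weighted Hardy inequality
  \<open>((k + \<alpha> - 2) / 2)\<^sup>2 \<integral> |p|\<^bsup>\<alpha>-2\<^esup> |X|\<^sup>2 \<le> \<integral> |p|\<^sup>\<alpha> |\<nabla>\<^sup>\<bottom> X|\<^sup>2\<close>, whose constant is at least \<open>k - 1 - \<alpha>\<close> exactly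
  when \<open>(k + \<alpha>)\<^sup>2 \<ge> 8 (k - 1)\<close>. Only radial derivatives enter it, so no polar coordinates are needed:
  the scaling law of the Hausdorff measure yields Euler's identity \<open>\<integral> D\<^sub>p g = - k \<integral> g\<close> on a cone,
  and this replaces the integration by parts.
\<close>

section \<open>Calculus of \<open>C\<^sup>1\<close> and \<open>C\<^sup>2\<close> maps\<close>

text \<open>The constants all come from one trace. Block \<open>i\<close> has \<open>k_i + 1\<close>
  dimensions and loses \<open>1 - \<rho>_i\<close> of them to the normal space, so over a tangent
  frame its form has trace \<open>k_i + \<rho>_i = k \<rho>_i\<close>. Proportionality to
  \<open>\<rho>_i\<close> is what the radii are made for: it kills the mean curvature, and in the
  squared second fundamental form it gives \<open>k\<close> times
  \<open>\<Sum> c_i^2 \<rho>_i\<close>, from which the ruling \<open>p\<close>, a null direction of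
  B, takes away one unit.

  The obstacle is that tangent frame, normal projection, derivative along \<open>M\<close> and
  second fundamental form are given by choice or by unique description. Each is first replaced by a
  closed expression in the blocks. The frame is chosen point by point without any continuity, so
  frame sums become sums over the ambient basis before they are integrated. On the measure side only
  covers are at hand: Lipschitz charts and grids show that compact pieces of a submanifold have
  finite measure, which supplies integrability and the majorant needed to differentiate under the
  integral in Euler's identity.\<close>

lemma C1_onI:
  assumes "\<And>x. x \<in> W \<Longrightarrow> (f has_derivative blinfun_apply (f' x)) (at x)"
    and "continuous_on W f'"
  shows "C1_on W f"
  using assms unfolding C1_on_def by blast

lemma C2_onI:
  assumes "\<And>x. x \<in> W \<Longrightarrow> (f has_derivative blinfun_apply (f' x)) (at x)"
    and "C1_on W f'"
  shows "C2_on W f"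
  using assms unfolding C2_on_def by blast

lemma C1_on_imp_continuous_on: "C1_on W f \<Longrightarrow> continuous_on W f"
  unfolding C1_on_def
  by (auto intro!: continuous_at_imp_continuous_on dest: has_derivative_continuous)

lemma C2_on_imp_C1_on: "C2_on W f \<Longrightarrow> C1_on W f"
  unfolding C2_on_def by (auto intro: C1_onI dest: C1_on_imp_continuous_on)

lemma C1_on_const [simp]: "C1_on W (\<lambda>x. c)"
  by (rule C1_onI[where f' = "\<lambda>x. 0"]) (auto simp: zero_blinfun.rep_eq)

lemma (in bounded_linear) C1_on_comp:
  assumes "C1_on W g" shows "C1_on W (\<lambda>x. f (g x))"
proof -
  obtain g' where g': "\<And>x. x \<in> W \<Longrightarrow> (g has_derivative blinfun_apply (g' x)) (at x)" "continuous_on W g'"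
    using assms unfolding C1_on_def by blast
  show ?thesis
  proof (rule C1_onI[where f' = "\<lambda>x. Blinfun f o\<^sub>L g' x"])
    show "((\<lambda>x. f (g x)) has_derivative blinfun_apply (Blinfun f o\<^sub>L g' x)) (at x)" if "x \<in> W" for x
      using has_derivative[OF g'(1)[OF that]]
      by (simp add: bounded_linear_Blinfun_apply bounded_linear_axioms blinfun_compose.rep_eq o_def)
    show "continuous_on W (\<lambda>x. Blinfun f o\<^sub>L g' x)"
      by (intro continuous_intros g'(2))
  qed
qed

lemma C1_on_bounded_linear:
  assumes "bounded_linear f" shows "C1_on W f"
  by (rule C1_onI[where f' = "\<lambda>x. Blinfun f"])
     (auto simp: bounded_linear_Blinfun_apply assms intro: bounded_linear_imp_has_derivative assms)

lemma C2_on_bounded_linear: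
  assumes "bounded_linear f" shows "C2_on W f"
  by (rule C2_onI[where f' = "\<lambda>x. Blinfun f"])
     (auto simp: bounded_linear_Blinfun_apply assms intro: bounded_linear_imp_has_derivative assms)

lemma C1_on_compose:
  assumes g: "C1_on V g" and f: "C1_on W f" and "f ` W \<subseteq> V"
  shows "C1_on W (\<lambda>x. g (f x))"
proof -
  obtain g' where g': "\<And>x. x \<in> V \<Longrightarrow> (g has_derivative blinfun_apply (g' x)) (at x)" "continuous_on V g'"
    using g unfolding C1_on_def by blast
  obtain f' where f': "\<And>x. x \<in> W \<Longrightarrow> (f has_derivative blinfun_apply (f' x)) (at x)" "continuous_on W f'"
    using f unfolding C1_on_def by blast
  show ?thesis
  proof (rule C1_onI[where f' = "\<lambda>x. g' (f x) o\<^sub>L f' x"])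
    fix x assume x: "x \<in> W"
    have "((\<lambda>x. g (f x)) has_derivative (\<lambda>h. g' (f x) (f' x h))) (at x)"
      by (rule has_derivative_compose[OF f'(1)[OF x] g'(1)]) (use x assms(3) in auto)
    then show "((\<lambda>x. g (f x)) has_derivative blinfun_apply (g' (f x) o\<^sub>L f' x)) (at x)"
      by (simp add: o_def blinfun_compose.rep_eq)
  next
    have "continuous_on W (\<lambda>x. g' (f x))"
      by (rule continuous_on_compose2[OF g'(2) C1_on_imp_continuous_on[OF f] assms(3)])
    then show "continuous_on W (\<lambda>x. g' (f x) o\<^sub>L f' x)"
      using f'(2) by (intro continuous_intros)
  qed
qed

context bounded_bilinear begin

text \<open>The product rule is stated inside the space of bounded linear maps, as a sum of
  compositions, so that the regularity of the derivative as a function of \<open>x\<close> can be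
  read off; both the C1 and the C2 product rule rest on this form.\<close>

lemma has_derivative_blinfun:
  assumes "(f has_derivative blinfun_apply f') (at x)" "(g has_derivative blinfun_apply g') (at x)"
  shows "((\<lambda>x. prod (f x) (g x)) has_derivative
    blinfun_apply ((prod_right (f x) o\<^sub>L g') + (prod_left (g x) o\<^sub>L f'))) (at x)"
  using FDERIV[OF assms] by (simp add: blinfun.bilinear_simps plus_blinfun.rep_eq)

lemma C1_on_prod:
  assumes f: "C1_on W f" and g: "C1_on W g"
  shows "C1_on W (\<lambda>x. prod (f x) (g x))"
proof -
  obtain g' where g': "\<And>x. x \<in> W \<Longrightarrow> (g has_derivative blinfun_apply (g' x)) (at x)" "continuous_on W g'"
    using g unfolding C1_on_def by blast
  obtain f' where f': "\<And>x. x \<in> W \<Longrightarrow> (f has_derivative blinfun_apply (f' x)) (at x)" "continuous_on W f'"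
    using f unfolding C1_on_def by blast
  have "continuous_on W (\<lambda>x. prod_right (f x))" "continuous_on W (\<lambda>x. prod_left (g x))"
    using f g C1_on_imp_continuous_on bounded_linear.continuous_on
      bounded_linear_prod_left bounded_linear_prod_right by blast+
  then show ?thesis
    by (intro C1_onI[OF has_derivative_blinfun[OF f'(1) g'(1)]])
      (auto intro!: continuous_intros f'(2) g'(2))
qed

end

lemma C1_on_add: "C1_on W f \<Longrightarrow> C1_on W g \<Longrightarrow> C1_on W (\<lambda>x. f x + g x)"
  unfolding C1_on_def
proof (elim exE conjE)
  fix f' g'
  assume "\<forall>x\<in>W. (f has_derivative blinfun_apply (f' x)) (at x)" "continuous_on W f'"
    "\<forall>x\<in>W. (g has_derivative blinfun_apply (g' x)) (at x)" "continuous_on W g'"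
  then show "\<exists>h'. (\<forall>x\<in>W. ((\<lambda>x. f x + g x) has_derivative blinfun_apply (h' x)) (at x)) \<and> continuous_on W h'"
    by (intro exI[of _ "\<lambda>x. f' x + g' x"])
       (auto intro!: continuous_intros has_derivative_eq_rhs[OF has_derivative_add] simp: plus_blinfun.rep_eq)
qed

lemma C2_on_add: "C2_on W f \<Longrightarrow> C2_on W g \<Longrightarrow> C2_on W (\<lambda>x. f x + g x)"
  unfolding C2_on_def
proof (elim exE conjE)
  fix f' g'
  assume "\<forall>x\<in>W. (f has_derivative blinfun_apply (f' x)) (at x)" "C1_on W f'"
    "\<forall>x\<in>W. (g has_derivative blinfun_apply (g' x)) (at x)" "C1_on W g'"
  then show "\<exists>h'. (\<forall>x\<in>W. ((\<lambda>x. f x + g x) has_derivative blinfun_apply (h' x)) (at x)) \<and> C1_on W h'"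
    by (intro exI[of _ "\<lambda>x. f' x + g' x"])
       (auto intro!: C1_on_add has_derivative_eq_rhs[OF has_derivative_add] simp: plus_blinfun.rep_eq)
qed

lemma (in bounded_bilinear) C2_on_prod:
  assumes f: "C2_on W f" and g: "C2_on W g"
  shows "C2_on W (\<lambda>x. prod (f x) (g x))"
proof -
  obtain g' where g': "\<And>x. x \<in> W \<Longrightarrow> (g has_derivative blinfun_apply (g' x)) (at x)" "C1_on W g'"
    using g unfolding C2_on_def by blast
  obtain f' where f': "\<And>x. x \<in> W \<Longrightarrow> (f has_derivative blinfun_apply (f' x)) (at x)" "C1_on W f'"
    using f unfolding C2_on_def by blast
  have "C1_on W (\<lambda>x. prod_right (f x))"
    by (rule bounded_linear.C1_on_comp[OF bounded_linear_prod_right C2_on_imp_C1_on[OF f]])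
  moreover have "C1_on W (\<lambda>x. prod_left (g x))"
    by (rule bounded_linear.C1_on_comp[OF bounded_linear_prod_left C2_on_imp_C1_on[OF g]])
  ultimately show ?thesis
    by (intro C2_onI[OF has_derivative_blinfun[OF f'(1) g'(1)]])
       (auto intro!: C1_on_add bounded_bilinear.C1_on_prod[OF bounded_bilinear_blinfun_compose] f'(2) g'(2))
qed

lemma C2_on_compose:
  assumes g: "C2_on V g" and f: "C2_on W f" and "f ` W \<subseteq> V"
  shows "C2_on W (\<lambda>x. g (f x))"
proof -
  obtain g' where g': "\<And>x. x \<in> V \<Longrightarrow> (g has_derivative blinfun_apply (g' x)) (at x)" "C1_on V g'"
    using g unfolding C2_on_def by blast
  obtain f' where f': "\<And>x. x \<in> W \<Longrightarrow> (f has_derivative blinfun_apply (f' x)) (at x)" "C1_on W f'"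
    using f unfolding C2_on_def by blast
  show ?thesis
  proof (rule C2_onI[where f' = "\<lambda>x. g' (f x) o\<^sub>L f' x"])
    fix x assume x: "x \<in> W"
    have "((\<lambda>x. g (f x)) has_derivative (\<lambda>h. g' (f x) (f' x h))) (at x)"
      by (rule has_derivative_compose[OF f'(1)[OF x] g'(1)]) (use x assms(3) in auto)
    then show "((\<lambda>x. g (f x)) has_derivative blinfun_apply (g' (f x) o\<^sub>L f' x)) (at x)"
      by (simp add: o_def blinfun_compose.rep_eq)
  next
    show "C1_on W (\<lambda>x. g' (f x) o\<^sub>L f' x)"
      by (intro bounded_bilinear.C1_on_prod[OF bounded_bilinear_blinfun_compose]
          C1_on_compose[OF g'(2) C2_on_imp_C1_on[OF f] assms(3)] f'(2))
  qed
qed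

lemma C1_on_real:
  fixes f :: "real \<Rightarrow> real"
  assumes "\<And>x. x \<in> W \<Longrightarrow> (f has_real_derivative f' x) (at x)" "continuous_on W f'"
  shows "C1_on W f"
  by (rule C1_onI[where f' = "\<lambda>x. f' x *\<^sub>R id_blinfun"])
     (use assms in \<open>auto intro!: continuous_intros simp: scaleR_blinfun.rep_eq has_field_derivative_def\<close>)

lemma C2_on_real:
  fixes f :: "real \<Rightarrow> real"
  assumes "\<And>x. x \<in> W \<Longrightarrow> (f has_real_derivative f' x) (at x)" "C1_on W f'"
  shows "C2_on W f"
  by (rule C2_onI[where f' = "\<lambda>x. f' x *\<^sub>R id_blinfun"])
     (use assms in \<open>auto intro!: bounded_bilinear.C1_on_prod[OF bounded_bilinear_scaleR] simp: scaleR_blinfun.rep_eq has_field_derivative_def\<close>)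

lemma C1_on_inverse: "C1_on (- {0}) (inverse :: real \<Rightarrow> real)"
  by (rule C1_on_real[where f' = "\<lambda>x. - inverse (x^2)"])
     (auto intro!: derivative_eq_intros continuous_intros simp: power2_eq_square)

lemma C2_on_sqrt: "C2_on {0<..} sqrt"
proof (rule C2_on_real[where f' = "\<lambda>x. inverse (sqrt x) / 2"])
  show "C1_on {0<..} (\<lambda>x. inverse (sqrt x) / 2)"
    by (rule C1_on_real[where f' = "\<lambda>x. - (inverse (sqrt x ^ 3) / 4)"])
       (auto intro!: derivative_eq_intros continuous_intros simp: power3_eq_cube field_simps)
qed (auto intro!: derivative_eq_intros simp: field_simps)

lemma C1_on_sum:
  "(\<And>i. i \<in> I \<Longrightarrow> C1_on W (f i)) \<Longrightarrow> C1_on W (\<lambda>x. \<Sum>i\<in>I. f i x)"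
  by (induction I rule: infinite_finite_induct) (auto intro: C1_on_add)

lemma C2_on_const: "C2_on W (\<lambda>x. c)"
  by (rule C2_onI[where f' = "\<lambda>x. 0"]) (auto simp: zero_blinfun.rep_eq)

lemma C2_on_sum:
  "(\<And>i. i \<in> I \<Longrightarrow> C2_on W (f i)) \<Longrightarrow> C2_on W (\<lambda>x. \<Sum>i\<in>I. f i x)"
  by (induction I rule: infinite_finite_induct) (auto intro: C2_on_add C2_on_const)

lemma C2_on_mult:
  fixes f g :: "_ \<Rightarrow> real"
  shows "C2_on W f \<Longrightarrow> C2_on W g \<Longrightarrow> C2_on W (\<lambda>x. f x * g x)"
  by (rule bounded_bilinear.C2_on_prod[OF bounded_bilinear_mult])

lemma C2_on_diff:
  fixes f g :: "_ \<Rightarrow> real"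
  shows "C2_on W f \<Longrightarrow> C2_on W g \<Longrightarrow> C2_on W (\<lambda>x. f x - g x)"
  using C2_on_add[OF _ C2_on_mult[OF C2_on_const[of W "-1"]], of f g] by simp

text \<open>Links the calculus above to the notion of C1 curve that occurs in
  \<open>tan_space\<close>.\<close>

lemma C1_on_imp_C1_differentiable_on:
  fixes f :: "real \<Rightarrow> 'b::real_normed_vector"
  assumes "C1_on W f" shows "f C1_differentiable_on W"
proof -
  obtain f' where f': "\<And>x. x \<in> W \<Longrightarrow> (f has_derivative blinfun_apply (f' x)) (at x)" "continuous_on W f'"
    using assms unfolding C1_on_def by blast
  have "(f has_vector_derivative f' x 1) (at x)" if "x \<in> W" for x
  proof -
    have "blinfun_apply (f' x) = (\<lambda>h. h *\<^sub>R f' x 1)"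
    proof
      show "f' x h = h *\<^sub>R f' x 1" for h
        using blinfun.scaleR_right[of "f' x" h 1] by (simp only: real_scaleR_def mult_1_right)
    qed
    then show ?thesis using f'(1)[OF that] unfolding has_vector_derivative_def by metis
  qed
  moreover have "continuous_on W (\<lambda>x. f' x 1)"
    by (rule bounded_linear.continuous_on[OF blinfun.bounded_linear_left f'(2)])
  ultimately show ?thesis
    unfolding C1_differentiable_on_def by (intro exI[of _ "\<lambda>x. f' x 1"]) simp
qed

section \<open>Tangential derivatives and powers of the norm\<close>

text \<open>A derivative within \<open>M\<close> is accessible only along curves in
  \<open>M\<close>; there the chain rule gives an ordinary two-sided derivative. Uniqueness of
  tangential derivatives, the tangent equations of the cone and the radial derivative in the Hardy
  inequality are all obtained through this.\<close>

lemma has_derivative_within_curve: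
  assumes Y: "(Y has_derivative L) (at p within M)"
    and \<gamma>: "0 < \<epsilon>" "\<gamma> ` {-\<epsilon><..<\<epsilon>} \<subseteq> M" "\<gamma> 0 = p" "(\<gamma> has_vector_derivative v) (at 0)"
  shows "((\<lambda>t. Y (\<gamma> t)) has_vector_derivative L v) (at 0)"
proof -
  have o: "open {-\<epsilon><..<\<epsilon>}" "(0::real) \<in> {-\<epsilon><..<\<epsilon>}" using \<gamma>(1) by auto
  have "(\<gamma> has_derivative (\<lambda>h. h *\<^sub>R v)) (at 0 within {-\<epsilon><..<\<epsilon>})"
    using \<gamma>(4) unfolding has_vector_derivative_def by (rule has_derivative_at_withinI)
  moreover have "(Y has_derivative L) (at (\<gamma> 0) within \<gamma> ` {-\<epsilon><..<\<epsilon>})"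
    using has_derivative_subset[OF Y \<gamma>(2)] \<gamma>(3) by simp
  ultimately have "((Y \<circ> \<gamma>) has_derivative (L \<circ> (\<lambda>h. h *\<^sub>R v))) (at 0 within {-\<epsilon><..<\<epsilon>})"
    by (rule diff_chain_within)
  then have "((Y \<circ> \<gamma>) has_derivative (L \<circ> (\<lambda>h. h *\<^sub>R v))) (at 0)"
    using at_within_open[OF o(2,1)] by simp
  moreover have "L (h *\<^sub>R v) = h *\<^sub>R L v" for h
    by (rule linear_simps(5)[OF has_derivative_bounded_linear[OF Y]])
  ultimately show ?thesis unfolding has_vector_derivative_def o_def by simp
qed

text \<open>Both values are the velocity at 0 of \<open>Y\<close> along one curve with velocity
  \<open>v\<close>. This makes the description in \<open>flat_deriv\<close> well defined.\<close>

lemma tangential_derivative_unique: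
  assumes "(Y has_derivative L) (at p within M)" "(Y has_derivative L') (at p within M)"
    and v: "v \<in> tan_space M p"
  shows "L v = L' v"
proof -
  obtain \<gamma> \<epsilon> where g: "0 < \<epsilon>" "\<gamma> ` {-\<epsilon><..<\<epsilon>} \<subseteq> M" "\<gamma> 0 = p" "(\<gamma> has_vector_derivative v) (at 0)"
    using v unfolding tan_space_def by blast
  show ?thesis
    using vector_derivative_unique_at[OF has_derivative_within_curve[OF assms(1) g] has_derivative_within_curve[OF assms(2) g]] .
qed

lemma flat_deriv_eqI:
  assumes Y: "(Y has_derivative L) (at p within M)" and v: "v \<in> tan_space M p"
  shows "flat_deriv M Y p v = L v"
  unfolding flat_deriv_def
proof (rule the_equality)
  fix d assume "\<exists>L. (Y has_derivative L) (at p within M) \<and> d = L v"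
  then show "d = L v" using tangential_derivative_unique[OF _ Y v] by metis
qed (use Y in blast)

text \<open>Besides a derivative at \<open>p\<close>, the extension provides one at every nearby
  point of \<open>M\<close>, and these depend continuously on the point.\<close>

lemma C1_along_local_extension:
  assumes "C1_along M Y" "p \<in> M"
  obtains W Z Z' where "open W" "p \<in> W" "\<And>x. x \<in> M \<inter> W \<Longrightarrow> Y x = Z x"
    "\<And>x. x \<in> W \<Longrightarrow> (Z has_derivative blinfun_apply (Z' x)) (at x)" "continuous_on W Z'"
    "\<And>x. x \<in> M \<inter> W \<Longrightarrow> (Y has_derivative blinfun_apply (Z' x)) (at x within M)"
proof -
  obtain W Z where W: "open W" "p \<in> W" "C1_on W Z" and eq: "\<forall>x \<in> M \<inter> W. Y x = Z x"
    using assms unfolding C1_along_def by metis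
  obtain Z' where Z': "\<And>x. x \<in> W \<Longrightarrow> (Z has_derivative blinfun_apply (Z' x)) (at x)" "continuous_on W Z'"
    using W(3) unfolding C1_on_def by blast
  have "(Y has_derivative blinfun_apply (Z' x)) (at x within M)" if x: "x \<in> M \<inter> W" for x
  proof -
    have "(Z has_derivative blinfun_apply (Z' x)) (at x within M)"
      using Z'(1) x by (auto intro: has_derivative_at_withinI)
    then have "(Z has_derivative blinfun_apply (Z' x)) (at x within M \<inter> W)"
      by (rule has_derivative_subset) auto
    then have "(Y has_derivative blinfun_apply (Z' x)) (at x within M \<inter> W)"
      by (rule has_derivative_transform[rotated 2]) (use x eq in auto)
    moreover have "at x within M \<inter> W = at x within M"
      by (rule at_within_nhd[of _ W]) (use W(1) x in auto)
    ultimately show ?thesis by simp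
  qed
  then show ?thesis using that W eq Z' by blast
qed

text \<open>The segment through \<open>\<Phi> p\<close> in direction \<open>L v\<close> stays in the
  subspace \<open>S\<close>, and \<open>\<Psi>\<close> carries it to a curve in \<open>M\<close>.
  Its velocity is \<open>v\<close> because the derivative of \<open>\<Psi>\<close> inverts
  \<open>L\<close>.\<close>

lemma chart_velocity_in_tan_space:
  assumes W: "open W" "p \<in> W" and W': "open W'" and \<Psi>: "C1_on W' \<Psi>"
    and \<Phi>: "(\<Phi> has_derivative L) (at p)" "\<Phi> ` W \<subseteq> W'" "\<And>x. x \<in> W \<Longrightarrow> \<Psi> (\<Phi> x) = x"
    and S: "subspace S" "\<Psi> ` (S \<inter> W') \<subseteq> M" "\<Phi> p \<in> S" "L v \<in> S"
  shows "v \<in> tan_space M p"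
proof -
  have "\<Phi> p \<in> W'" using W \<Phi> by auto
  then obtain e where e: "e > 0" "ball (\<Phi> p) e \<subseteq> W'" using W' open_contains_ball by blast
  \<comment> \<open>The summand 1 keeps the denominator positive when
    \<open>L v = 0\<close>.\<close>
  define \<epsilon> where "\<epsilon> = e / (norm (L v) + 1)"
  have \<epsilon>: "\<epsilon> > 0" using e by (simp add: \<epsilon>_def add_nonneg_pos)
  have mem: "\<Phi> p + t *\<^sub>R L v \<in> S \<inter> W'" if "t \<in> {-\<epsilon><..<\<epsilon>}" for t
  proof -
    have "\<bar>t\<bar> * norm (L v) \<le> \<bar>t\<bar> * (norm (L v) + 1)" by (simp add: mult_left_mono)
    also have "\<dots> < \<epsilon> * (norm (L v) + 1)" using that by (intro mult_strict_right_mono) (auto simp: add_nonneg_pos)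
    also have "\<dots> = e" by (simp add: \<epsilon>_def add_nonneg_eq_0_iff)
    finally have "\<Phi> p + t *\<^sub>R L v \<in> ball (\<Phi> p) e" by (simp add: dist_norm)
    then show ?thesis using e S by (auto intro: subspace_add subspace_scale)
  qed
  define \<gamma> where "\<gamma> t = \<Psi> (\<Phi> p + t *\<^sub>R L v)" for t
  have aff: "C1_on {-\<epsilon><..<\<epsilon>} (\<lambda>t. \<Phi> p + t *\<^sub>R L v)"
    by (intro C1_on_add C1_on_const C1_on_bounded_linear bounded_linear_scaleR_left)
  have "C1_on {-\<epsilon><..<\<epsilon>} \<gamma>"
    unfolding \<gamma>_def by (rule C1_on_compose[OF \<Psi> aff]) (use mem in auto)
  then have c1: "\<gamma> C1_differentiable_on {-\<epsilon><..<\<epsilon>}" by (rule C1_on_imp_C1_differentiable_on)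
  obtain L' where L': "(\<Psi> has_derivative L') (at (\<Phi> p))"
    using \<Psi> \<open>\<Phi> p \<in> W'\<close> unfolding C1_on_def by blast
  have "((\<lambda>x. \<Psi> (\<Phi> x)) has_derivative (\<lambda>x. L' (L x))) (at p)"
    by (rule has_derivative_compose[OF \<Phi>(1) L'])
  moreover have "((\<lambda>x. \<Psi> (\<Phi> x)) has_derivative (\<lambda>x. x)) (at p)"
    by (rule has_derivative_transform_within_open[OF has_derivative_ident W]) (simp add: \<Phi>)
  ultimately have LL: "L' (L v) = v" using has_derivative_unique by metis
  have a: "((\<lambda>t. \<Phi> p + t *\<^sub>R L v) has_derivative (\<lambda>t. t *\<^sub>R L v)) (at 0)"
    by (auto intro!: derivative_eq_intros)
  have "(\<Psi> has_derivative L') (at (\<Phi> p + 0 *\<^sub>R L v))" using L' by simp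
  from has_derivative_compose[OF a this] have "(\<gamma> has_derivative (\<lambda>t. L' (t *\<^sub>R L v))) (at 0)"
    by (simp add: \<gamma>_def[abs_def])
  moreover have "L' (t *\<^sub>R L v) = t *\<^sub>R v" for t
    using LL L' by (simp add: linear_simps(5) has_derivative_bounded_linear)
  ultimately have "(\<gamma> has_vector_derivative v) (at 0)" by (simp add: has_vector_derivative_def)
  moreover have "\<gamma> ` {-\<epsilon><..<\<epsilon>} \<subseteq> M" using mem S(2) by (auto simp: \<gamma>_def)
  moreover have "\<gamma> 0 = p" using \<Phi> W by (simp add: \<gamma>_def)
  ultimately show ?thesis using \<epsilon> c1 unfolding tan_space_def by blast
qed

section \<open>Orthonormal families\<close>

lemma orthonormal_sum_inner_squares:
  assumes "finite E" "pairwise orthogonal E" "\<And>e. e \<in> E \<Longrightarrow> norm e = 1" "x \<in> span E"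
  shows "(\<Sum>e\<in>E. (e \<bullet> x)\<^sup>2) = x \<bullet> x"
proof -
  have "x \<bullet> x = (\<Sum>e\<in>E. (x \<bullet> e) *\<^sub>R e) \<bullet> x"
    using orthonormal_basis_expand[OF assms(2,3,4,1)] by simp
  also have "\<dots> = (\<Sum>e\<in>E. (e \<bullet> x)\<^sup>2)"
    unfolding inner_sum_left by (rule sum.cong) (simp_all add: inner_commute power2_eq_square)
  finally show ?thesis by (rule sym)
qed

text \<open>The operator norm is at most the Hilbert-Schmidt norm. It serves to bound the radial
  derivative alone by the full normal gradient.\<close>

lemma norm_linear_le_orthonormal:
  fixes A :: "'a::euclidean_space \<Rightarrow> 'b::real_normed_vector"
  assumes "finite E" "pairwise orthogonal E" "\<And>e. e \<in> E \<Longrightarrow> norm e = 1" "x \<in> span E" "linear A"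
  shows "(norm (A x))\<^sup>2 \<le> (x \<bullet> x) * (\<Sum>e\<in>E. (norm (A e))\<^sup>2)"
proof -
  have "A x = A (\<Sum>e\<in>E. (x \<bullet> e) *\<^sub>R e)"
    using orthonormal_basis_expand[OF assms(2,3,4,1)] by simp
  also have "\<dots> = (\<Sum>e\<in>E. (x \<bullet> e) *\<^sub>R A e)"
    using assms(5) by (simp add: linear_sum linear_scale)
  also have "norm \<dots> \<le> (\<Sum>e\<in>E. \<bar>e \<bullet> x\<bar> * norm (A e))"
    by (rule sum_norm_le) (simp add: inner_commute)
  finally have "(norm (A x))\<^sup>2 \<le> (\<Sum>e\<in>E. \<bar>e \<bullet> x\<bar> * norm (A e))\<^sup>2" by (simp add: power_mono)
  also have "\<dots> \<le> (\<Sum>e\<in>E. \<bar>e \<bullet> x\<bar>\<^sup>2) * (\<Sum>e\<in>E. (norm (A e))\<^sup>2)"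
    by (rule Cauchy_Schwarz_ineq_sum)
  finally show ?thesis using orthonormal_sum_inner_squares[OF assms(1-4)] by simp
qed

section \<open>Gradient and Hessian of powers of the norm\<close>

lemma has_derivative_norm_powr:
  fixes x :: "'a::real_inner"
  assumes "x \<noteq> 0"
  shows "((\<lambda>x. norm x powr a) has_derivative (\<lambda>h. a * norm x powr (a - 2) * (x \<bullet> h))) (at x)"
proof -
  have "((\<lambda>x. norm x powr a) has_derivative
    (\<lambda>h. norm x powr a * (0 * ln (norm x) + (h \<bullet> sgn x) * a / norm x))) (at x)"
    by (rule has_derivative_powr[OF has_derivative_norm[OF assms] has_derivative_const]) (use assms in auto)
  moreover have "norm x powr a * (0 * ln (norm x) + (h \<bullet> sgn x) * a / norm x)
      = a * norm x powr (a - 2) * (x \<bullet> h)" for h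
    using assms by (simp add: sgn_div_norm powr_diff inner_commute power2_eq_square field_simps)
  ultimately show ?thesis by simp
qed

lemma grad_norm_powr:
  fixes p :: "'a::euclidean_space"
  assumes "p \<noteq> 0"
  shows "grad (\<lambda>x. norm x powr a) p = (a * norm p powr (a - 2)) *\<^sub>R p"
  unfolding grad_def
proof (rule the_equality)
  have d: "((\<lambda>x. norm x powr a) has_derivative (\<lambda>h. h \<bullet> ((a * norm p powr (a - 2)) *\<^sub>R p))) (at p)"
    using has_derivative_norm_powr[OF assms, of a] by (simp add: inner_commute)
  then show "GDERIV (\<lambda>x. norm x powr a) p :> (a * norm p powr (a - 2)) *\<^sub>R p"
    by (simp add: gderiv_def)
  fix g assume "GDERIV (\<lambda>x. norm x powr a) p :> g"
  then have "((\<lambda>x. norm x powr a) has_derivative (\<lambda>h. h \<bullet> g)) (at p)" by (simp add: gderiv_def)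
  from has_derivative_unique[OF this d] have "\<forall>h. h \<bullet> g = h \<bullet> ((a * norm p powr (a - 2)) *\<^sub>R p)"
    unfolding fun_eq_iff .
  then show "g = (a * norm p powr (a - 2)) *\<^sub>R p" by (simp only: vector_eq_ldot)
qed

text \<open>Differentiating the power in the gradient produces a rank-one term with the factor
  \<open>p \<bullet> v\<close>, which vanishes here; only the multiple of the identity
  survives.\<close>

lemma hess_norm_powr_orthogonal:
  fixes p v :: "'a::euclidean_space"
  assumes "p \<noteq> 0" "p \<bullet> v = 0"
  shows "hess (\<lambda>x. norm x powr a) p v v = a * norm p powr (a - 2) * (v \<bullet> v)"
proof -
  have fd: "frechet_derivative (\<lambda>x. norm x powr a) (at x) v = a * norm x powr (a - 2) * (x \<bullet> v)"
    if "x \<noteq> 0" for x :: 'a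
    by (simp add: frechet_derivative_at[OF has_derivative_norm_powr[OF that, of a], symmetric])
  have "((\<lambda>x. a * norm x powr (a - 2) * (x \<bullet> v)) has_derivative
     (\<lambda>h. (a * norm p powr (a - 2)) * (h \<bullet> v) + (a * ((a - 2) * norm p powr (a - 2 - 2) * (p \<bullet> h))) * (p \<bullet> v))) (at p)"
    by (intro has_derivative_mult has_derivative_mult_right has_derivative_norm_powr assms
        bounded_linear_imp_has_derivative bounded_linear_inner_left)
  then have "((\<lambda>x. frechet_derivative (\<lambda>x. norm x powr a) (at x) v) has_derivative
     (\<lambda>h. (a * norm p powr (a - 2)) * (h \<bullet> v) + (a * ((a - 2) * norm p powr (a - 2 - 2) * (p \<bullet> h))) * (p \<bullet> v))) (at p)"
    by (rule has_derivative_transform_within_open[of _ _ _ _ "- {0}"]) (use assms fd in auto)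
  note e = frechet_derivative_at[OF this, symmetric]
  show ?thesis unfolding hess_def e using assms(2) by simp
qed

lemma continuous_on_locally:
  fixes f :: "'a::euclidean_space \<Rightarrow> 'b::topological_space"
  assumes "\<And>p. p \<in> M \<Longrightarrow> \<exists>W. open W \<and> p \<in> W \<and> continuous_on (M \<inter> W) f"
  shows "continuous_on M f"
  unfolding continuous_on_eq_continuous_within
proof (rule ballI)
  fix p assume p: "p \<in> M"
  then obtain W where W: "open W" "p \<in> W" "continuous_on (M \<inter> W) f" using assms by blast
  have "continuous (at p within M \<inter> W) f" using W p by (simp add: continuous_on_eq_continuous_within)
  moreover have "at p within M \<inter> W = at p within M" by (rule at_within_nhd[of _ W]) (use W in auto)
  ultimately show "continuous (at p within M) f" by simp
qed

section \<open>Hausdorff measure: scaling, local finiteness, Euler's identity\<close>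

text \<open>Dilating a cover multiplies every diameter by at most \<open>t\<close>. Only this
  inequality is proved by hand; the reverse one is the same statement for the inverse
  dilation.\<close>

lemma hausdorff_pre_scale_le:
  fixes A :: "'a::euclidean_space set"
  assumes t: "0 < t"
  shows "ennreal (inverse t ^ k) * hausdorff_pre k (t * \<delta>) ((*\<^sub>R) t ` A) \<le> hausdorff_pre k \<delta> A"
  unfolding hausdorff_pre_def[of k \<delta> A]
proof (rule INF_greatest)
  fix C :: "nat \<Rightarrow> 'a set"
  assume "C \<in> {C. A \<subseteq> (\<Union>i. C i) \<and> (\<forall>i. bounded (C i) \<and> diameter (C i) \<le> \<delta>)}"
  then have C: "A \<subseteq> (\<Union>i. C i)" "\<And>i. bounded (C i)" "\<And>i. diameter (C i) \<le> \<delta>" by auto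
  define v where "v i = unit_ball_vol (real k) * (diameter (C i) / 2) ^ k" for i
  have v: "v i \<ge> 0" for i
    unfolding v_def using diameter_ge_0[OF C(2)[of i]] by (intro mult_nonneg_nonneg) auto
  have diam: "diameter ((*\<^sub>R) t ` C i) \<le> t * diameter (C i)" for i
  proof (rule diameter_le)
    show "(*\<^sub>R) t ` C i \<noteq> {} \<or> 0 \<le> t * diameter (C i)"
      using t diameter_ge_0[OF C(2)] by simp
    show "norm (x - y) \<le> t * diameter (C i)" if xy: "x \<in> (*\<^sub>R) t ` C i" "y \<in> (*\<^sub>R) t ` C i" for x y
    proof -
      obtain x' y' where x': "x' \<in> C i" "x = t *\<^sub>R x'" and y': "y' \<in> C i" "y = t *\<^sub>R y'" using xy by auto
      have "x - y = t *\<^sub>R (x' - y')" by (simp add: x' y' scaleR_diff_right)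
      then have "norm (x - y) = t * dist x' y'" using t by (simp add: dist_norm)
      then show ?thesis using diameter_bounded_bound[OF C(2) x'(1) y'(1)] t by simp
    qed
  qed
  have "hausdorff_pre k (t * \<delta>) ((*\<^sub>R) t ` A) \<le>
    (\<Sum>i. if (*\<^sub>R) t ` C i = {} then 0
       else ennreal (unit_ball_vol (real k) * (diameter ((*\<^sub>R) t ` C i) / 2) ^ k))"
    unfolding hausdorff_pre_def
  proof (rule INF_lower, intro CollectI conjI allI)
    show "(*\<^sub>R) t ` A \<subseteq> (\<Union>i. (*\<^sub>R) t ` C i)" using C(1) by blast
    show "bounded ((*\<^sub>R) t ` C i)" for i by (intro bounded_scaling C)
    show "diameter ((*\<^sub>R) t ` C i) \<le> t * \<delta>" for i
      using order_trans[OF diam mult_left_mono[OF C(3)[of i], of t]] t by simp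
  qed
  also have "\<dots> \<le> (\<Sum>i. ennreal (t ^ k) * (if C i = {} then 0 else ennreal (v i)))"
  proof (intro suminf_le summableI)
    fix i
    have "unit_ball_vol (real k) * (diameter ((*\<^sub>R) t ` C i) / 2) ^ k
        \<le> unit_ball_vol (real k) * (t * diameter (C i) / 2) ^ k"
      using diam[of i] C(2)
      by (intro mult_left_mono power_mono divide_right_mono)
        (auto intro!: divide_nonneg_nonneg diameter_ge_0 bounded_scaling)
    also have "\<dots> = t ^ k * v i" by (simp add: v_def power_mult_distrib power_divide)
    finally show "(if (*\<^sub>R) t ` C i = {} then 0
       else ennreal (unit_ball_vol (real k) * (diameter ((*\<^sub>R) t ` C i) / 2) ^ k))
       \<le> ennreal (t ^ k) * (if C i = {} then 0 else ennreal (v i))"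
      using t v by (auto simp: ennreal_mult[symmetric] intro!: ennreal_leI)
  qed
  also have "\<dots> = ennreal (t ^ k) * (\<Sum>i. if C i = {} then 0 else ennreal (v i))"
    by (rule ennreal_suminf_cmult)
  finally have "ennreal (inverse t ^ k) * hausdorff_pre k (t * \<delta>) ((*\<^sub>R) t ` A)
     \<le> ennreal (inverse t ^ k) * (ennreal (t ^ k) * (\<Sum>i. if C i = {} then 0 else ennreal (v i)))"
    by (rule mult_left_mono) simp
  also have "\<dots> = ennreal (inverse t ^ k * t ^ k) * (\<Sum>i. if C i = {} then 0 else ennreal (v i))"
    using t by (simp add: ennreal_mult mult.assoc)
  also have "inverse t ^ k * t ^ k = 1" using t by (simp flip: power_mult_distrib)
  finally show "ennreal (inverse t ^ k) * hausdorff_pre k (t * \<delta>) ((*\<^sub>R) t ` A)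
     \<le> (\<Sum>i. if C i = {} then 0 else ennreal (unit_ball_vol (real k) * (diameter (C i) / 2) ^ k))"
    unfolding v_def by simp
qed

lemma hausdorff_outer_scale_le:
  fixes A :: "'a::euclidean_space set"
  assumes t: "0 < t"
  shows "ennreal (inverse t ^ k) * hausdorff_outer k ((*\<^sub>R) t ` A) \<le> hausdorff_outer k A"
  unfolding hausdorff_outer_def SUP_mult_left_ennreal
proof (rule SUP_mono)
  fix \<delta> :: real assume "\<delta> \<in> {0<..}"
  then show "\<exists>\<delta>'\<in>{0<..}. ennreal (inverse t ^ k) * hausdorff_pre k \<delta> ((*\<^sub>R) t ` A) \<le> hausdorff_pre k \<delta>' A"
    using hausdorff_pre_scale_le[OF t, of k "\<delta> / t" A] t by (intro bexI[of _ "\<delta> / t"]) auto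
qed

lemma hausdorff_outer_scale:
  fixes A :: "'a::euclidean_space set"
  assumes t: "0 < t"
  shows "hausdorff_outer k ((*\<^sub>R) t ` A) = ennreal (t ^ k) * hausdorff_outer k A"
proof (rule antisym)
  have "ennreal (t ^ k) * (ennreal (inverse t ^ k) * hausdorff_outer k ((*\<^sub>R) t ` A))
     \<le> ennreal (t ^ k) * hausdorff_outer k A"
    by (intro mult_left_mono hausdorff_outer_scale_le t) simp
  moreover have "ennreal (t ^ k) * (ennreal (inverse t ^ k) * X) = X" for X
  proof -
    have "ennreal (t ^ k) * (ennreal (inverse t ^ k) * X) = ennreal (t ^ k * inverse t ^ k) * X"
      using t by (simp add: ennreal_mult mult.assoc)
    also have "t ^ k * inverse t ^ k = 1" using t by (simp flip: power_mult_distrib)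
    finally show ?thesis by simp
  qed
  ultimately show "hausdorff_outer k ((*\<^sub>R) t ` A) \<le> ennreal (t ^ k) * hausdorff_outer k A" by simp
  \<comment> \<open>The dilated set, shrunk by \<open>inverse t\<close>, is \<open>A\<close>
    again.\<close>
  have "(*\<^sub>R) (inverse t) ` (*\<^sub>R) t ` A = A" using t by (simp add: image_comp o_def)
  then show "ennreal (t ^ k) * hausdorff_outer k A \<le> hausdorff_outer k ((*\<^sub>R) t ` A)"
    using hausdorff_outer_scale_le[of "inverse t" k "(*\<^sub>R) t ` A"] t by simp
qed

section \<open>The Hausdorff measure on Borel sets under dilation\<close>

lemma space_hausdorff_measure [simp]: "space (hausdorff_measure k) = UNIV"
  unfolding hausdorff_measure_def by (simp add: space_measure_of_conv)

lemma sets_hausdorff_measure [simp, measurable_cong]: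
  "sets (hausdorff_measure k :: 'a::euclidean_space measure) = sets borel"
  unfolding hausdorff_measure_def using sets.sigma_sets_eq[of "borel :: 'a measure"]
  by (simp add: sets_measure_of_conv)

text \<open>\<open>measure_of\<close> falls back to the zero measure if its set function is not a
  measure. The case distinction keeps both values, and both of them scale by
  \<open>t ^ k\<close>.\<close>

lemma emeasure_hausdorff_measure:
  fixes B :: "'a::euclidean_space set"
  assumes "B \<in> sets borel"
  shows "emeasure (hausdorff_measure k) B =
    (if measure_space UNIV (sets borel) (hausdorff_outer k :: 'a set \<Rightarrow> ennreal) then hausdorff_outer k B else 0)"
  unfolding hausdorff_measure_def emeasure_measure_of_conv
  using assms sets.sigma_sets_eq[of "borel :: 'a measure"] by simp

lemma scaleR_image_borel:
  fixes B :: "'a::euclidean_space set"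
  assumes "t \<noteq> 0" "B \<in> sets borel"
  shows "(*\<^sub>R) t ` B \<in> sets borel"
proof -
  have "(\<lambda>x. inverse t *\<^sub>R x) -` B \<inter> space borel \<in> sets borel"
    by (rule measurable_sets[OF borel_measurable_continuous_onI assms(2)]) (intro continuous_intros)
  moreover have "(\<lambda>x. inverse t *\<^sub>R x) -` B = (*\<^sub>R) t ` B"
    using assms(1) by (auto simp: image_iff intro!: bexI[of _ "inverse t *\<^sub>R _"])
  ultimately show ?thesis by simp
qed

lemma emeasure_hausdorff_measure_scale:
  fixes B :: "'a::euclidean_space set"
  assumes "0 < t" "B \<in> sets borel"
  shows "emeasure (hausdorff_measure k) ((*\<^sub>R) t ` B) = ennreal (t ^ k) * emeasure (hausdorff_measure k) B"
  using assms by (simp add: emeasure_hausdorff_measure scaleR_image_borel hausdorff_outer_scale)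

lemma integral_hausdorff_measure_scale:
  fixes g :: "'a::euclidean_space \<Rightarrow> real"
  assumes t: "0 < t" and g: "g \<in> borel_measurable borel"
  shows "(LINT x|hausdorff_measure k. g (t *\<^sub>R x)) = inverse t ^ k * (LINT x|hausdorff_measure k. g x)"
proof -
  let ?\<mu> = "hausdorff_measure k :: 'a measure"
  have m: "(\<lambda>x::'a. t *\<^sub>R x) \<in> ?\<mu> \<rightarrow>\<^sub>M borel"
    by (subst measurable_cong_sets[OF sets_hausdorff_measure refl]) measurable
  have g': "g \<in> borel_measurable ?\<mu>" using g by (simp add: measurable_cong_sets[OF sets_hausdorff_measure refl])
  \<comment> \<open>The preimage of \<open>A\<close> under dilation by \<open>t\<close> is
    \<open>A\<close> shrunk by \<open>t\<close>, so the push-forward is the original measure with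
    constant density.\<close>
  have "distr ?\<mu> borel (\<lambda>x. t *\<^sub>R x) = density ?\<mu> (\<lambda>_. ennreal (inverse t ^ k))"
  proof (rule measure_eqI)
    fix A :: "'a set" assume "A \<in> sets (distr ?\<mu> borel (\<lambda>x. t *\<^sub>R x))"
    then have A: "A \<in> sets borel" by simp
    have "(\<lambda>x. t *\<^sub>R x) -` A = (*\<^sub>R) (inverse t) ` A"
      using t by (auto simp: image_iff intro!: bexI[of _ "t *\<^sub>R _"])
    then have "emeasure (distr ?\<mu> borel (\<lambda>x. t *\<^sub>R x)) A = emeasure ?\<mu> ((*\<^sub>R) (inverse t) ` A)"
      using A m by (simp add: emeasure_distr)
    also have "\<dots> = ennreal (inverse t ^ k) * emeasure ?\<mu> A"
      using t A by (intro emeasure_hausdorff_measure_scale) auto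
    finally show "emeasure (distr ?\<mu> borel (\<lambda>x. t *\<^sub>R x)) A = emeasure (density ?\<mu> (\<lambda>_. ennreal (inverse t ^ k))) A"
      using A by (simp add: emeasure_density_const)
  qed simp
  then have "(LINT x|?\<mu>. g (t *\<^sub>R x)) = (LINT x|density ?\<mu> (\<lambda>_. ennreal (inverse t ^ k)). g x)"
    using integral_distr[OF m g] by simp
  also have "\<dots> = inverse t ^ k * (LINT x|?\<mu>. g x)"
    using t g' by (subst integral_density) auto
  finally show ?thesis .
qed

text \<open>At most \<open>b * N ^ k\<close> sets of diameter \<open>c / N\<close> contribute a
  total of at most \<open>V\<close>, in which \<open>N\<close> cancels; hence one bound serves every
  scale \<delta>.\<close>

lemma hausdorff_outer_finite_of_covers:
  fixes A :: "'a::euclidean_space set"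
  assumes c: "0 < c" and b: "0 \<le> b"
    and cov: "\<And>N::nat. 1 \<le> N \<Longrightarrow> \<exists>F. finite F \<and> real (card F) \<le> b * real N ^ k \<and> A \<subseteq> \<Union>F \<and>
      (\<forall>B\<in>F. bounded B \<and> diameter B \<le> c / real N)"
  shows "hausdorff_outer k A < \<infinity>"
proof -
  define V where "V = b * (unit_ball_vol (real k) * (c / 2) ^ k)"
  have "hausdorff_pre k \<delta> A \<le> ennreal V" if "0 < \<delta>" for \<delta>
  proof -
    obtain N :: nat where N: "c / \<delta> < real N" using reals_Archimedean2 by blast
    then have "0 < real N" using c that by (meson divide_pos_pos less_trans)
    then have N1: "1 \<le> N" by simp
    have cN: "c / real N \<le> \<delta>"
      using N \<open>0 < real N\<close> that by (simp add: field_simps)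
    obtain F where F: "finite F" "real (card F) \<le> b * real N ^ k" "A \<subseteq> \<Union>F"
      "\<And>B. B \<in> F \<Longrightarrow> bounded B" "\<And>B. B \<in> F \<Longrightarrow> diameter B \<le> c / real N"
      using cov[OF N1] by blast
    obtain h where h: "bij_betw h {0..<card F} F" using ex_bij_betw_nat_finite[OF F(1)] by blast
    \<comment> \<open>Covers are sequences, so the finite family is padded with empty sets, which
      count as 0.\<close>
    define C where "C i = (if i < card F then h i else {})" for i
    have hF: "h i \<in> F" if "i < card F" for i using h that by (auto simp: bij_betw_def)
    have "hausdorff_pre k \<delta> A
      \<le> (\<Sum>i. if C i = {} then 0 else ennreal (unit_ball_vol (real k) * (diameter (C i) / 2) ^ k))"
      unfolding hausdorff_pre_def
    proof (rule INF_lower, intro CollectI conjI allI)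
      show "A \<subseteq> (\<Union>i. C i)"
      proof
        fix x assume "x \<in> A"
        then obtain B where "B \<in> F" "x \<in> B" using F(3) by blast
        then have "B \<in> h ` {0..<card F}" using bij_betw_imp_surj_on[OF h] by simp
        then obtain i where "i \<in> {0..<card F}" "h i = B" by (rule imageE) simp
        then show "x \<in> (\<Union>i. C i)" using \<open>x \<in> B\<close> by (auto simp: C_def intro!: exI[of _ i])
      qed
      show "bounded (C i)" for i using hF F(4) by (simp add: C_def)
      show "diameter (C i) \<le> \<delta>" for i using hF F(5) cN that by (fastforce simp: C_def)
    qed
    also have "\<dots> = (\<Sum>i<card F. if C i = {} then 0 else ennreal (unit_ball_vol (real k) * (diameter (C i) / 2) ^ k))"
      by (rule suminf_finite) (auto simp: C_def)
    also have "\<dots> \<le> (\<Sum>i<card F. ennreal (unit_ball_vol (real k) * (c / real N / 2) ^ k))"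
    proof (rule sum_mono)
      fix i assume "i \<in> {..<card F}"
      then have "diameter (C i) \<le> c / real N" "0 \<le> diameter (C i)"
        using hF F(4,5) by (auto simp: C_def intro: diameter_ge_0)
      then show "(if C i = {} then 0 else ennreal (unit_ball_vol (real k) * (diameter (C i) / 2) ^ k))
          \<le> ennreal (unit_ball_vol (real k) * (c / real N / 2) ^ k)"
        by (auto intro!: ennreal_leI mult_left_mono power_mono)
    qed
    also have "\<dots> = ennreal (real (card F) * (unit_ball_vol (real k) * (c / real N / 2) ^ k))"
      using c by (simp add: ennreal_mult ennreal_of_nat_eq_real_of_nat)
    also have "\<dots> \<le> ennreal ((b * real N ^ k) * (unit_ball_vol (real k) * (c / real N / 2) ^ k))"
      using c by (intro ennreal_leI mult_right_mono F) auto
    also have "(b * real N ^ k) * (unit_ball_vol (real k) * (c / real N / 2) ^ k) = V"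
      using N1 by (simp add: V_def power_divide)
    finally show ?thesis .
  qed
  then have "hausdorff_outer k A \<le> ennreal V"
    unfolding hausdorff_outer_def by (intro SUP_least) auto
  also have "\<dots> < \<infinity>" by simp
  finally show ?thesis .
qed

text \<open>A grid in the coordinates of an orthonormal basis of \<open>S\<close> cuts
  \<open>A\<close> into cells of width \<open>2 * R / N\<close>; the images of the cells form the
  required covers.\<close>

lemma hausdorff_outer_Lipschitz_image_finite:
  fixes \<Psi> :: "'a::euclidean_space \<Rightarrow> 'b::euclidean_space"
  assumes S: "subspace S" "dim S = k" and A: "A \<subseteq> S" "A \<subseteq> cball y R" and R: "0 < R"
    and L: "0 \<le> L" "\<And>u v. u \<in> A \<Longrightarrow> v \<in> A \<Longrightarrow> norm (\<Psi> u - \<Psi> v) \<le> L * norm (u - v)"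
  shows "hausdorff_outer k (\<Psi> ` A) < \<infinity>"
proof -
  obtain E where E: "E \<subseteq> S" "pairwise orthogonal E" "\<And>x. x \<in> E \<Longrightarrow> norm x = 1"
    "independent E" "card E = dim S" "span E = S"
    using orthonormal_basis_subspace[OF S(1)] by metis
  have fE: "finite E" using E(4) by (rule independent_imp_finite)
  \<comment> \<open>In \<open>c\<close>, the factor \<open>real k * (2 * R)\<close> bounds the norm
    by the sum of \<open>k\<close> coordinates, and the summand 1 makes \<open>c\<close> positive
    even if \<open>L\<close> or \<open>k\<close> is 0. The bound
    \<open>(N + 1) ^ k \<le> (2 * N) ^ k\<close> on the number of cells gives
    \<open>b\<close>.\<close>
  show ?thesis
  proof (rule hausdorff_outer_finite_of_covers[where c = "L * (real k * (2 * R)) + 1" and b = "2 ^ k"])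
    fix N :: nat assume N: "1 \<le> N"
    \<comment> \<open>The coordinate along \<open>e\<close>, rescaled from \<open>[-R, R]\<close> to
      \<open>[0, N]\<close>. The right end point has index \<open>N\<close>, so there are
      \<open>N + 1\<close> indices per direction.\<close>
    define w where "w z e = ((z - y) \<bullet> e + R) * real N / (2 * R)" for z e
    define idx where "idx z = restrict (\<lambda>e. nat \<lfloor>w z e\<rfloor>) E" for z
    define F where "F = (\<lambda>j. \<Psi> ` {z \<in> A. idx z = j}) ` (E \<rightarrow>\<^sub>E {..N})"
    have wbd: "0 \<le> w z e \<and> w z e \<le> real N" if "z \<in> A" "e \<in> E" for z e
    proof -
      have "\<bar>(z - y) \<bullet> e\<bar> \<le> norm (z - y) * norm e" by (rule Cauchy_Schwarz_ineq2)
      also have "\<dots> \<le> R" using that A E(3) by (auto simp: dist_norm norm_minus_commute)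
      finally have "0 \<le> (z - y) \<bullet> e + R" "(z - y) \<bullet> e + R \<le> 2 * R" by linarith+
      then show ?thesis using R mult_right_mono[of "(z - y) \<bullet> e + R" "2 * R" "real N"]
        by (simp add: w_def pos_divide_le_eq mult.commute)
    qed
    have idx_in: "idx z \<in> E \<rightarrow>\<^sub>E {..N}" if "z \<in> A" for z
      using wbd[OF that] by (fastforce simp: idx_def nat_le_iff floor_le_iff)
    have "card F \<le> card (E \<rightarrow>\<^sub>E {..N})" unfolding F_def by (intro card_image_le finite_PiE fE) auto
    also have "\<dots> = (N + 1) ^ k" using fE E(5) S(2) by (simp add: card_PiE)
    also have "\<dots> \<le> (2 * N) ^ k" using N by (intro power_mono) auto
    finally have "real (card F) \<le> real ((2 * N) ^ k)" by linarith
    then have card: "real (card F) \<le> 2 ^ k * real N ^ k" by (simp add: power_mult_distrib)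
    have close: "norm (\<Psi> u - \<Psi> v) \<le> (L * (real k * (2 * R)) + 1) / real N"
      if u: "u \<in> A" and v: "v \<in> A" and uv: "idx u = idx v" for u v
    proof -
      have e: "\<bar>(u - v) \<bullet> e\<bar> \<le> 2 * R / real N" if "e \<in> E" for e
      proof -
        have "nat \<lfloor>w u e\<rfloor> = nat \<lfloor>w v e\<rfloor>" using fun_cong[OF uv, of e] that by (simp add: idx_def)
        then have "\<lfloor>w u e\<rfloor> = \<lfloor>w v e\<rfloor>" using wbd[OF u that] wbd[OF v that] by (simp add: nat_eq_iff split: if_splits)
        then have "\<bar>w u e - w v e\<bar> \<le> 1" by linarith
        moreover have "w u e - w v e = ((u - v) \<bullet> e) * (real N / (2 * R))"
          by (simp add: w_def algebra_simps inner_diff_left diff_divide_distrib add_divide_distrib)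
        ultimately have "\<bar>(u - v) \<bullet> e\<bar> * (real N / (2 * R)) \<le> 1" using R by (simp add: abs_mult)
        then show ?thesis using R N by (simp add: field_simps)
      qed
      have "u - v \<in> span E" using u v A E(6) S(1) by (auto intro: subspace_diff)
      then have "norm (u - v) = norm (\<Sum>e\<in>E. ((u - v) \<bullet> e) *\<^sub>R e)"
        using orthonormal_basis_expand[OF E(2,3) _ fE] by simp
      also have "\<dots> \<le> (\<Sum>e\<in>E. 2 * R / real N)"
        by (rule sum_norm_le) (simp add: E(3) e)
      also have "\<dots> = real k * (2 * R) / real N" using E(5) S(2) by simp
      finally have "L * norm (u - v) \<le> L * (real k * (2 * R) / real N)" using L(1) by (rule mult_left_mono)
      also have "\<dots> \<le> (L * (real k * (2 * R)) + 1) / real N" using N by (simp add: add_divide_distrib)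
      finally show ?thesis using L(2)[OF u v] by linarith
    qed
    show "\<exists>F. finite F \<and> real (card F) \<le> 2 ^ k * real N ^ k \<and> \<Psi> ` A \<subseteq> \<Union>F \<and>
      (\<forall>B\<in>F. bounded B \<and> diameter B \<le> (L * (real k * (2 * R)) + 1) / real N)"
    proof (intro exI[of _ F] conjI ballI)
      show "finite F" unfolding F_def by (intro finite_imageI finite_PiE fE) auto
      show "\<Psi> ` A \<subseteq> \<Union>F" using idx_in by (auto simp: F_def)
      fix B assume "B \<in> F"
      then obtain j where B: "B = \<Psi> ` {z \<in> A. idx z = j}" by (auto simp: F_def)
      have *: "norm (a - b) \<le> (L * (real k * (2 * R)) + 1) / real N" if "a \<in> B" "b \<in> B" for a b
        using that close by (auto simp: B)
      show "diameter B \<le> (L * (real k * (2 * R)) + 1) / real N"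
        using L(1) R by (intro diameter_le *) auto
      show "bounded B"
      proof (cases "B = {}")
        case False
        then obtain a where "a \<in> B" by blast
        then show ?thesis unfolding bounded_def using * by (auto simp: dist_norm)
      qed simp
    qed (rule card)
  qed (use L(1) R in \<open>auto intro!: add_nonneg_pos\<close>)
qed

text \<open>The inverse chart is Lipschitz on a closed ball, by compactness and convexity. The image
  of the whole disc \<open>S \<inter> cball (\<Phi> p) e\<close> is returned since it is compact,
  hence Borel, so that its outer measure controls the measure.\<close>

lemma C2_submanifold_locally_finite:
  fixes M :: "'a::euclidean_space set"
  assumes M: "C2_submanifold k M" and p: "p \<in> M"
  obtains V A where "open V" "p \<in> V" "compact A" "M \<inter> V \<subseteq> A" "hausdorff_outer k A < \<infinity>"
proof -
  obtain W W' S and \<Phi> \<Psi> :: "'a \<Rightarrow> 'a" where W: "open W" "p \<in> W" "open W'"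
    and C2: "C2_on W \<Phi>" "C2_on W' \<Psi>" and im: "\<Phi> ` W = W'"
    and inv: "\<forall>x\<in>W. \<Psi> (\<Phi> x) = x"
    and S: "subspace S" "dim S = k" "\<Phi> ` (M \<inter> W) = S \<inter> W'"
    using bspec[OF M[unfolded C2_submanifold_def] p] by (elim exE conjE)
  have pW: "\<Phi> p \<in> W'" using W im by auto
  then obtain e where e: "e > 0" "cball (\<Phi> p) e \<subseteq> W'" using W(3) open_contains_cball by blast
  obtain \<Psi>' where \<Psi>': "\<And>x. x \<in> W' \<Longrightarrow> (\<Psi> has_derivative blinfun_apply (\<Psi>' x)) (at x)" "continuous_on W' \<Psi>'"
    using C2_on_imp_C1_on[OF C2(2)] unfolding C1_on_def by blast
  have "compact (\<Psi>' ` cball (\<Phi> p) e)"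
    by (rule compact_continuous_image[OF continuous_on_subset[OF \<Psi>'(2) e(2)]]) simp
  from compact_imp_bounded[OF this] obtain B where "\<forall>y\<in>\<Psi>' ` cball (\<Phi> p) e. norm y \<le> B"
    unfolding bounded_iff ..
  then have B: "norm (\<Psi>' x) \<le> B" if "x \<in> cball (\<Phi> p) e" for x using that by simp
  have B0: "0 \<le> B" using B[of "\<Phi> p"] e(1) norm_ge_zero order_trans by (metis centre_in_cball less_imp_le)
  have lip: "norm (\<Psi> u - \<Psi> v) \<le> B * norm (u - v)" if "u \<in> cball (\<Phi> p) e" "v \<in> cball (\<Phi> p) e" for u v
  proof (rule differentiable_bound[OF convex_cball _ _ that])
    show "(\<Psi> has_derivative blinfun_apply (\<Psi>' x)) (at x within cball (\<Phi> p) e)" if "x \<in> cball (\<Phi> p) e" for x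
      using \<Psi>'(1) e(2) that by (blast intro: has_derivative_at_withinI)
    show "onorm (blinfun_apply (\<Psi>' x)) \<le> B" if "x \<in> cball (\<Phi> p) e" for x
      using B[OF that] by (simp add: norm_blinfun.rep_eq)
  qed
  define A where "A = \<Psi> ` (S \<inter> cball (\<Phi> p) e)"
  define V where "V = W \<inter> \<Phi> -` ball (\<Phi> p) e"
  show ?thesis
  proof
    show "open V" unfolding V_def
      using C1_on_imp_continuous_on[OF C2_on_imp_C1_on[OF C2(1)]] W(1)
      by (intro continuous_open_preimage) auto
    show "p \<in> V" using W e by (simp add: V_def)
    have "compact (S \<inter> cball (\<Phi> p) e)" by (intro closed_Int_compact closed_subspace S) simp
    moreover have "continuous_on (S \<inter> cball (\<Phi> p) e) \<Psi>"
      by (rule continuous_on_subset[OF C1_on_imp_continuous_on[OF C2_on_imp_C1_on[OF C2(2)]]]) (use e in auto)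
    ultimately show "compact A" unfolding A_def by (intro compact_continuous_image)
    show "M \<inter> V \<subseteq> A"
    proof
      fix x assume x: "x \<in> M \<inter> V"
      then have "\<Phi> x \<in> S \<inter> cball (\<Phi> p) e" using S(3) by (auto simp: V_def)
      moreover have "x = \<Psi> (\<Phi> x)" using x inv unfolding V_def by (metis IntD1 IntD2)
      ultimately show "x \<in> A" unfolding A_def by blast
    qed
    show "hausdorff_outer k A < \<infinity>"
      unfolding A_def using S e B0 lip
      by (intro hausdorff_outer_Lipschitz_image_finite[where S = S and L = B and R = e]) auto
  qed
qed

lemma C2_submanifold_emeasure_compact_finite:
  fixes M :: "'a::euclidean_space set"
  assumes M: "C2_submanifold k M" and K: "compact K" "K \<subseteq> M"
  shows "emeasure (hausdorff_measure k) K < \<infinity>"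
proof -
  have "\<forall>p\<in>K. \<exists>V A. open V \<and> p \<in> V \<and> compact A \<and> M \<inter> V \<subseteq> A \<and> hausdorff_outer k A < \<infinity>"
    using C2_submanifold_locally_finite[OF M] K(2) by (metis subsetD)
  then obtain V A where VA: "\<And>p. p \<in> K \<Longrightarrow> open (V p) \<and> p \<in> V p \<and> compact (A p) \<and> M \<inter> V p \<subseteq> A p \<and> hausdorff_outer k (A p) < \<infinity>"
    by metis
  have "\<And>p. p \<in> K \<Longrightarrow> open (V p)" "K \<subseteq> (\<Union>p\<in>K. V p)" using VA by auto
  then obtain D where D: "D \<subseteq> K" "finite D" "K \<subseteq> (\<Union>p\<in>D. V p)"
    by (rule compactE_image[OF K(1)])
  have bor: "A p \<in> sets borel" if "p \<in> D" for p
    using VA D that by (blast intro: borel_compact)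
  have "K \<subseteq> (\<Union>p\<in>D. A p)" using D VA K(2) by blast
  then have "emeasure (hausdorff_measure k) K \<le> emeasure (hausdorff_measure k) (\<Union>p\<in>D. A p)"
    using bor D(2) by (intro emeasure_mono) auto
  also have "\<dots> \<le> (\<Sum>p\<in>D. emeasure (hausdorff_measure k) (A p))"
    using bor D(2) by (intro emeasure_subadditive_finite) auto
  also have "\<dots> < \<infinity>"
    using VA D bor by (auto simp: emeasure_hausdorff_measure)
  finally show ?thesis .
qed

section \<open>Integration of compactly supported functions on a cone\<close>

lemma set_integrable_continuous_compact_support:
  fixes M :: "'a::euclidean_space set" and g :: "'a \<Rightarrow> real"
  assumes M: "C2_submanifold k M" "M \<in> sets borel" and K: "compact K" "K \<subseteq> M"
    and g: "continuous_on M g" "\<And>x. x \<in> M - K \<Longrightarrow> g x = 0"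
  shows "set_integrable (hausdorff_measure k) M g"
proof -
  have "compact (g ` K)" using g(1) K by (blast intro: compact_continuous_image continuous_on_subset)
  from compact_imp_bounded[OF this] obtain B where "\<forall>y\<in>g ` K. norm y \<le> B"
    unfolding bounded_iff ..
  then have B: "\<bar>g x\<bar> \<le> B" if "x \<in> K" for x using that by simp
  show ?thesis unfolding set_integrable_def
  proof (rule integrableI_bounded_set[where A = K and B = B])
    show "K \<in> sets (hausdorff_measure k)" using K by (simp add: borel_compact)
    show "(\<lambda>x. indicator M x *\<^sub>R g x) \<in> borel_measurable (hausdorff_measure k)"
      using borel_measurable_continuous_on_indicator[OF M(2) g(1)]
      by (simp add: measurable_cong_sets[OF sets_hausdorff_measure refl])
    show "emeasure (hausdorff_measure k) K < \<infinity>" by (rule C2_submanifold_emeasure_compact_finite[OF M(1) K])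
  qed (use B g(2) K(2) in \<open>auto simp: indicator_def\<close>)
qed

text \<open>The integral of \<open>G (t *\<^sub>R x)\<close> over the cone is
  \<open>inverse t ^ k\<close> times that of \<open>G\<close>; the claim is the derivative of this
  equation at \<open>t = 1\<close>. Taking the derivative under the integral is dominated
  convergence for difference quotients.\<close>

lemma euler_identity_on_cone:
  fixes M :: "'a::euclidean_space set" and G H :: "'a \<Rightarrow> real"
  assumes M: "C2_submanifold k M" "M \<in> sets borel"
    and cone: "\<And>x t. x \<in> M \<Longrightarrow> 0 < t \<Longrightarrow> t *\<^sub>R x \<in> M"
    and K: "compact K" "K \<subseteq> M"
    and G: "continuous_on M G" and H: "continuous_on M H"
    and G0: "\<And>x. x \<in> M - K \<Longrightarrow> G x = 0" and H0: "\<And>x. x \<in> M - K \<Longrightarrow> H x = 0"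
    and deriv: "\<And>x. x \<in> M \<Longrightarrow> ((\<lambda>t. G (t *\<^sub>R x)) has_real_derivative H x) (at 1)"
  shows "(LINT x : M | hausdorff_measure k. H x) = - real k * (LINT x : M | hausdorff_measure k. G x)"
proof -
  let ?\<mu> = "hausdorff_measure k :: 'a measure"
  define I where "I = (LINT x : M | ?\<mu>. G x)"
  have mG: "(\<lambda>x. indicator M x *\<^sub>R G x) \<in> borel_measurable borel"
    by (rule borel_measurable_continuous_on_indicator[OF M(2) G])
  have mH: "(\<lambda>x. indicator M x *\<^sub>R H x) \<in> borel_measurable borel"
    by (rule borel_measurable_continuous_on_indicator[OF M(2) H])
  have coneiff: "t *\<^sub>R x \<in> M \<longleftrightarrow> x \<in> M" if "0 < t" for t x
    using cone[of "t *\<^sub>R x" "inverse t"] cone[of x t] that by auto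
  have scaled: "(\<lambda>x. indicator M x *\<^sub>R G (t *\<^sub>R x)) = (\<lambda>x. indicator M (t *\<^sub>R x) *\<^sub>R G (t *\<^sub>R x))" if "0 < t" for t
    using coneiff[OF that] by (auto simp: indicator_def)
  have mGt: "(\<lambda>x. indicator M x *\<^sub>R G (t *\<^sub>R x)) \<in> borel_measurable borel" if "0 < t" for t
    unfolding scaled[OF that] by (rule measurable_compose[OF _ mG]) measurable
  \<comment> \<open>The hypothesis at the point \<open>t *\<^sub>R x\<close> of the same ray,
    rescaled by the chain rule.\<close>
  have deriv': "((\<lambda>s. G (s *\<^sub>R x)) has_real_derivative H (t *\<^sub>R x) / t) (at t)" if x: "x \<in> M" and t: "0 < t" for x t
  proof -
    have d: "((\<lambda>s. s / t) has_real_derivative 1 / t) (at t)" using t by (auto intro!: derivative_eq_intros)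
    have "((\<lambda>s. G (s *\<^sub>R (t *\<^sub>R x))) has_real_derivative H (t *\<^sub>R x)) (at (t / t))"
      using deriv[OF cone[OF x t]] t by simp
    from DERIV_chain2[OF this d] show ?thesis using t by simp
  qed
  have "compact (H ` K)" using H K by (blast intro: compact_continuous_image continuous_on_subset)
  from compact_imp_bounded[OF this] obtain B where "\<forall>y\<in>H ` K. norm y \<le> B"
    unfolding bounded_iff ..
  then have B: "\<bar>H x\<bar> \<le> B" if "x \<in> K" for x using that by simp
  have BM: "\<bar>H x\<bar> \<le> max B 0" if "x \<in> M" for x using B[of x] H0[of x] that by (cases "x \<in> K") auto
  \<comment> \<open>If \<open>t *\<^sub>R x\<close> lies in \<open>K\<close> for some
    \<open>t\<close> between 1 and 2, then \<open>x\<close> lies in \<open>K'\<close>. So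
    \<open>K'\<close> carries all difference quotients with parameters in that range, and its
    indicator can serve in the majorant.\<close>
  define K' where "K' = (\<lambda>(s, y). s *\<^sub>R y) ` ({1/2..1} \<times> K)"
  have K': "compact K'" unfolding K'_def case_prod_beta
    by (intro compact_continuous_image compact_Times K compact_Icc continuous_intros)
  have K'M: "K' \<subseteq> M" using K(2) cone by (auto simp: K'_def)
  \<comment> \<open>Tends to 1 from above, never equals 1, and stays within the range
    \<open>[1, 2]\<close> for which \<open>K'\<close> was built.\<close>
  define \<tau> where "\<tau> n = 1 + 1 / (real n + 1)" for n
  have \<tau>: "1 < \<tau> n" "\<tau> n \<le> 2" for n by (auto simp: \<tau>_def)
  have "\<tau> \<longlonglongrightarrow> 1 + 0" unfolding \<tau>_def
    using LIMSEQ_inverse_real_of_nat by (intro tendsto_intros) (simp add: inverse_eq_divide add.commute)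
  then have "filterlim \<tau> (at 1) sequentially"
    using \<tau> by (auto simp: filterlim_at intro!: always_eventually) (metis less_irrefl)+
  note \<tau>lim = this
  define u where "u n x = indicator M x *\<^sub>R ((G (\<tau> n *\<^sub>R x) - G x) / (\<tau> n - 1))" for n x
  have bound: "\<bar>u n x\<bar> \<le> max B 0 * indicator K' x" for n x
  proof (cases "x \<in> M")
    case True
    \<comment> \<open>By the mean value theorem the quotient is a value of \<open>H\<close> on the
      ray divided by \<open>z > 1\<close>, which the bound of \<open>H\<close> dominates.\<close>
    obtain z where z: "1 < z" "z < \<tau> n" "G (\<tau> n *\<^sub>R x) - G (1 *\<^sub>R x) = (\<tau> n - 1) * (H (z *\<^sub>R x) / z)"
      using MVT2[of 1 "\<tau> n" "\<lambda>s. G (s *\<^sub>R x)" "\<lambda>t. H (t *\<^sub>R x) / t"] \<tau>(1) deriv'[OF True] by fastforce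
    have u: "u n x = H (z *\<^sub>R x) / z" using z(3) \<tau>(1)[of n] True by (simp add: u_def)
    show ?thesis
    proof (cases "z *\<^sub>R x \<in> K")
      case zK: True
      have "1 / z \<in> {1/2..1}" using z \<tau>(2)[of n] by (auto simp: field_simps)
      then have "x \<in> K'"
        unfolding K'_def using zK z by (intro image_eqI[where x = "(1 / z, z *\<^sub>R x)"]) auto
      moreover have "\<bar>H (z *\<^sub>R x)\<bar> / z \<le> max B 0 / 1"
        using BM[OF cone[OF True, of z]] z(1) by (intro frac_le) auto
      ultimately show ?thesis using z(1) u by simp
    next
      case False
      then show ?thesis using H0 cone[OF True, of z] z(1) u by simp
    qed
  qed (simp add: u_def)
  have lim: "(\<lambda>n. u n x) \<longlonglongrightarrow> indicator M x *\<^sub>R H x" for x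
  proof (cases "x \<in> M")
    case True
    have "((\<lambda>t. (G (t *\<^sub>R x) - G (1 *\<^sub>R x)) / (t - 1)) \<longlongrightarrow> H x) (at 1)"
      using deriv[OF True] by (simp add: has_field_derivative_iff)
    from filterlim_compose[OF this \<tau>lim] show ?thesis using True by (simp add: u_def)
  qed (simp add: u_def)
  have mu: "u n \<in> borel_measurable ?\<mu>" for n
  proof -
    have "u n = (\<lambda>x. (indicator M x *\<^sub>R G (\<tau> n *\<^sub>R x) - indicator M x *\<^sub>R G x) / (\<tau> n - 1))"
      by (auto simp: u_def indicator_def fun_eq_iff)
    also have "\<dots> \<in> borel_measurable borel"
      using mGt[of "\<tau> n"] mG \<tau>(1)[of n] by (intro borel_measurable_divide borel_measurable_diff) auto
    finally show ?thesis by (simp add: measurable_cong_sets[OF sets_hausdorff_measure refl])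
  qed
  have iG: "integrable ?\<mu> (\<lambda>x. indicator M x *\<^sub>R G x)"
    using set_integrable_continuous_compact_support[OF M K G G0] unfolding set_integrable_def by blast
  have intGt: "(LINT x|?\<mu>. indicator M x *\<^sub>R G (t *\<^sub>R x)) = inverse t ^ k * I" if t: "0 < t" for t
    unfolding scaled[OF t] using integral_hausdorff_measure_scale[OF t mG] by (simp add: I_def set_lebesgue_integral_def)
  have iGt: "integrable ?\<mu> (\<lambda>x. indicator M x *\<^sub>R G (t *\<^sub>R x))" if t: "1 \<le> t" "t \<le> 2" for t
  proof -
    have "continuous_on M (\<lambda>x. G (t *\<^sub>R x))"
      by (rule continuous_on_compose2[OF G]) (use cone t in \<open>auto intro!: continuous_intros\<close>)
    moreover have "G (t *\<^sub>R x) = 0" if "x \<in> M - K'" for x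
    proof -
      have "t *\<^sub>R x \<notin> K"
      proof
        assume "t *\<^sub>R x \<in> K"
        moreover have "1 / t \<in> {1/2..1}" using t by (auto simp: field_simps)
        ultimately have "x \<in> K'"
          unfolding K'_def using t by (intro image_eqI[where x = "(1 / t, t *\<^sub>R x)"]) auto
        then show False using that by simp
      qed
      then show ?thesis using G0 cone that t by simp
    qed
    ultimately show ?thesis
      using set_integrable_continuous_compact_support[OF M K' K'M, of "\<lambda>x. G (t *\<^sub>R x)"]
      unfolding set_integrable_def by blast
  qed
  have intu: "(LINT x|?\<mu>. u n x) = (inverse (\<tau> n) ^ k - inverse 1 ^ k) / (\<tau> n - 1) * I" for n
  proof -
    have "(LINT x|?\<mu>. u n x) =
      (LINT x|?\<mu>. (indicator M x *\<^sub>R G (\<tau> n *\<^sub>R x) - indicator M x *\<^sub>R G x) / (\<tau> n - 1))"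
      by (rule Bochner_Integration.integral_cong) (auto simp: u_def indicator_def)
    also have "\<dots> = ((LINT x|?\<mu>. indicator M x *\<^sub>R G (\<tau> n *\<^sub>R x)) - (LINT x|?\<mu>. indicator M x *\<^sub>R G x)) / (\<tau> n - 1)"
      using iG iGt[of "\<tau> n"] \<tau>[of n] by (simp add: Bochner_Integration.integral_diff)
    also have "\<dots> = (inverse (\<tau> n) ^ k * I - I) / (\<tau> n - 1)"
      using intGt[of "\<tau> n"] \<tau>(1)[of n] by (simp add: I_def set_lebesgue_integral_def)
    finally show ?thesis by (simp add: algebra_simps diff_divide_distrib)
  qed
  have "(\<lambda>n. LINT x|?\<mu>. u n x) \<longlonglongrightarrow> (LINT x|?\<mu>. indicator M x *\<^sub>R H x)"
  proof (rule integral_dominated_convergence[where w = "\<lambda>x. max B 0 * indicator K' x"])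
    show "(\<lambda>x. indicator M x *\<^sub>R H x) \<in> borel_measurable ?\<mu>"
      using mH by (simp add: measurable_cong_sets[OF sets_hausdorff_measure refl])
    show "integrable ?\<mu> (\<lambda>x. max B 0 * indicator K' x)"
      using C2_submanifold_emeasure_compact_finite[OF M(1) K' K'M] K'
      by (intro integrable_mult_right integrable_real_indicator) (auto simp: borel_compact)
  qed (use lim bound mu in auto)
  moreover have "(\<lambda>n. LINT x|?\<mu>. u n x) \<longlonglongrightarrow> - real k * I"
  proof -
    have "((\<lambda>t. inverse t ^ k) has_real_derivative - real k) (at 1)"
      by (auto intro!: derivative_eq_intros)
    then have "((\<lambda>t. (inverse t ^ k - inverse 1 ^ k) / (t - 1)) \<longlongrightarrow> - real k) (at (1::real))"
      by (simp add: has_field_derivative_iff)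
    from tendsto_mult_right[OF filterlim_compose[OF this \<tau>lim], of I] show ?thesis
      unfolding intu by simp
  qed
  ultimately show ?thesis
    unfolding I_def set_lebesgue_integral_def using LIMSEQ_unique by blast
qed

section \<open>The cone over a product of spheres\<close>

locale sphere_product_cone =
  fixes l k :: nat and ks :: "nat \<Rightarrow> nat" and blk :: "'n::finite \<Rightarrow> nat"
  assumes two_le_l: "2 \<le> l"
    and ks_pos: "\<And>i. i \<in> {1..l} \<Longrightarrow> 1 \<le> ks i"
    and blk_in: "\<And>a. blk a \<in> {1..l}"
    and card_blk: "\<And>i. i \<in> {1..l} \<Longrightarrow> card {a. blk a = i} = ks i + 1"
    and k_eq: "k = 1 + (\<Sum>i=1..l. ks i)"
begin

definition I :: "nat set" where "I = {1..l}"

definition \<rho> :: "nat \<Rightarrow> real" where "\<rho> i = real (ks i) / real (\<Sum>j=1..l. ks j)"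

definition q :: "nat \<Rightarrow> real ^ 'n \<Rightarrow> real ^ 'n \<Rightarrow> real" where
  "q i x y = (\<Sum>a | blk a = i. x $ a * y $ a)"

definition D :: "(nat \<Rightarrow> real) \<Rightarrow> real ^ 'n \<Rightarrow> real ^ 'n" where
  "D c x = (\<chi> a. c (blk a) * x $ a)"

text \<open>The cone without its vertex, written by homogeneous quadratic equations because these
  can be differentiated.\<close>

definition M :: "(real ^ 'n) set" where
  "M = {x. x \<noteq> 0 \<and> (\<forall>i\<in>I. q i x x = \<rho> i * (x \<bullet> x))}"

text \<open>The common kernel of the differentials of the equations of \<open>M\<close>.\<close>

definition T :: "real ^ 'n \<Rightarrow> (real ^ 'n) set" where
  "T x = {v. \<forall>i\<in>I. q i x v = \<rho> i * (x \<bullet> v)}"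

text \<open>For \<open>x\<close> in \<open>M\<close> this is the orthogonal projection onto the
  normal space: the coefficient of block \<open>i\<close> measures how far \<open>v\<close> violates
  the \<open>i\<close>-th equation of \<open>T x\<close>.\<close>

definition N :: "real ^ 'n \<Rightarrow> real ^ 'n \<Rightarrow> real ^ 'n" where
  "N x v = D (\<lambda>i. (q i x v / \<rho> i - x \<bullet> v) / (x \<bullet> x)) x"

section \<open>Algebra of block forms and block multipliers\<close>

lemma finite_I [simp]: "finite I" and card_I: "card I = l" and one_in_I: "1 \<in> I"
  using two_le_l by (auto simp: I_def)

lemma sum_ks: "real (\<Sum>i=1..l. ks i) = real k - 1" "real k - 1 > 0"
proof -
  have "(\<Sum>i=1..l. 1) \<le> (\<Sum>i=1..l. ks i)" using ks_pos by (intro sum_mono) auto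
  then have "l \<le> (\<Sum>i=1..l. ks i)" by simp
  then show "real (\<Sum>i=1..l. ks i) = real k - 1" "real k - 1 > 0" using two_le_l k_eq by linarith+
qed

lemma \<rho>_pos: "i \<in> I \<Longrightarrow> 0 < \<rho> i"
  using ks_pos sum_ks unfolding \<rho>_def I_def by (metis divide_pos_pos less_le_trans of_nat_0_less_iff zero_less_one)

lemma \<rho>_mult: "\<rho> i * (real k - 1) = real (ks i)"
  using sum_ks by (simp add: \<rho>_def)

lemma sum_\<rho>: "(\<Sum>i\<in>I. \<rho> i) = 1"
proof -
  have "(\<Sum>i\<in>I. \<rho> i) = (\<Sum>i\<in>I. real (ks i)) / (real k - 1)"
    unfolding \<rho>_def sum_ks by (rule sum_divide_distrib[symmetric])
  also have "(\<Sum>i\<in>I. real (ks i)) = real k - 1" using sum_ks(1) by (simp add: I_def)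
  finally show ?thesis using sum_ks(2) by simp
qed

lemma D_nth: "D c x $ a = c (blk a) * x $ a"
  by (simp add: D_def)

lemma inner_eq_sum_q: "x \<bullet> y = (\<Sum>i\<in>I. q i x y)"
proof -
  have "(\<Sum>i\<in>I. sum (\<lambda>a. x $ a * y $ a) {a \<in> UNIV. blk a = i}) = (\<Sum>a\<in>UNIV. x $ a * y $ a)"
    by (rule sum.group) (use blk_in in \<open>auto simp: I_def\<close>)
  then show ?thesis by (simp add: inner_vec_def q_def)
qed

lemma q_commute: "q i x y = q i y x"
  by (simp add: q_def mult.commute)

lemma q_D: "q i (D c x) y = c i * q i x y"
  unfolding q_def D_nth sum_distrib_left by (rule sum.cong) auto

lemma q_D_right: "q i x (D c y) = c i * q i x y"
  by (subst (1 2) q_commute) (rule q_D)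

lemma inner_D: "D c x \<bullet> y = (\<Sum>i\<in>I. c i * q i x y)"
  by (simp add: inner_eq_sum_q q_D)

lemma D_cong: "(\<And>i. i \<in> I \<Longrightarrow> c i = c' i) \<Longrightarrow> D c x = D c' x"
  using blk_in by (simp add: vec_eq_iff D_nth I_def)

lemma bounded_linear_D: "bounded_linear (D c)"
  unfolding linear_conv_bounded_linear[symmetric]
  by (intro linearI) (simp_all add: vec_eq_iff D_nth algebra_simps)

text \<open>Orthogonal projection onto block \<open>i\<close>. It turns \<open>q\<close> and
  \<open>D\<close> into combinations of bounded linear maps, to which the calculus of C1 and C2 maps
  applies.\<close>

definition P :: "nat \<Rightarrow> real ^ 'n \<Rightarrow> real ^ 'n" where "P i = D (\<lambda>j. of_bool (j = i))"

lemma q_eq_inner_P: "i \<in> I \<Longrightarrow> q i x y = P i x \<bullet> y"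
  by (simp add: P_def inner_D if_distrib[of "\<lambda>c. c * _"] of_bool_def cong: if_cong)

lemma D_eq_sum_P: "D c x = (\<Sum>i\<in>I. c i *\<^sub>R P i x)"
proof -
  have "(\<Sum>i\<in>I. c i * (of_bool (blk a = i) * x $ a)) = c (blk a) * x $ a" for a
    using blk_in[of a] by (simp add: I_def of_bool_def if_distrib[of "\<lambda>b. _ * (b * _)"] cong: if_cong)
  then show ?thesis by (simp add: vec_eq_iff D_nth P_def)
qed

lemma bounded_linear_P: "bounded_linear (P i)"
  unfolding P_def by (rule bounded_linear_D)

lemma q_linear:
  "q i (x + x') y = q i x y + q i x' y" "q i x (y + y') = q i x y + q i x y'"
  "q i (x - x') y = q i x y - q i x' y" "q i x (y - y') = q i x y - q i x y'"
  "q i (t *\<^sub>R x) y = t * q i x y" "q i x (t *\<^sub>R y) = t * q i x y"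
  "q i 0 y = 0" "q i x 0 = 0" "q i (- x) y = - q i x y" "q i x (- y) = - q i x y"
  by (simp_all add: q_def algebra_simps sum.distrib sum_subtractf sum_distrib_left sum_negf)

lemma q_sum: "q i (\<Sum>j\<in>J. f j) y = (\<Sum>j\<in>J. q i (f j) y)"
  by (induction J rule: infinite_finite_induct) (simp_all add: q_linear)

lemma bounded_bilinear_q:
  assumes "i \<in> I" shows "bounded_bilinear (q i)"
proof -
  have "q i = (\<lambda>x. (\<bullet>) (P i x))" by (intro ext) (rule q_eq_inner_P[OF assms])
  then show ?thesis
    using bounded_bilinear.comp1[OF bounded_bilinear_inner bounded_linear_P[of i]] by simp
qed

section \<open>The equations of the cone and its normal projection\<close>

lemma M_D:
  assumes "p \<in> M"
  shows "p \<noteq> 0" "0 < p \<bullet> p" "i \<in> I \<Longrightarrow> q i p p = \<rho> i * (p \<bullet> p)" "i \<in> I \<Longrightarrow> 0 < q i p p"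
  using assms \<rho>_pos by (auto simp: M_def)

lemma M_scaleR: "p \<in> M \<Longrightarrow> 0 < t \<Longrightarrow> t *\<^sub>R p \<in> M"
  by (auto simp: M_def q_linear)

text \<open>The squared radii sum to 1, so the product of spheres lies in the unit sphere; a point
  of \<open>M\<close> therefore returns to it when divided by its norm.\<close>

lemma M_eq_cone: "cone_over (sphere_product l blk (minimal_radius l ks)) - {0} = M"
proof -
  have L2: "L2_set (\<lambda>a. x $ a) {a. blk a = i} = minimal_radius l ks i \<longleftrightarrow> q i x x = \<rho> i" for x :: "real ^ 'n" and i
    unfolding L2_set_def minimal_radius_def \<rho>_def q_def by (simp add: power2_eq_square)
  have sp: "x \<in> sphere_product l blk (minimal_radius l ks) \<longleftrightarrow> (\<forall>i\<in>I. q i x x = \<rho> i)" for x :: "real ^ 'n"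
    unfolding sphere_product_def I_def by (simp add: L2)
  have unit: "x \<bullet> x = 1" if "\<forall>i\<in>I. q i x x = \<rho> i" for x :: "real ^ 'n"
    using that by (simp add: inner_eq_sum_q sum_\<rho>)
  show ?thesis
  proof (intro set_eqI iffI)
    fix y :: "real ^ 'n" assume "y \<in> cone_over (sphere_product l blk (minimal_radius l ks)) - {0}"
    then obtain t x where y: "y = t *\<^sub>R x" "y \<noteq> 0" "\<forall>i\<in>I. q i x x = \<rho> i"
      unfolding cone_over_def using sp by blast
    then show "y \<in> M" using unit[OF y(3)] by (simp add: M_def q_linear)
  next
    fix y assume y: "y \<in> M"
    define x where "x = (1 / norm y) *\<^sub>R y"
    have "q i x x = \<rho> i" if "i \<in> I" for i
      using M_D[OF y] that by (simp add: x_def q_linear flip: power2_norm_eq_inner) (simp add: power2_eq_square)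
    then have "x \<in> sphere_product l blk (minimal_radius l ks)" using sp by simp
    moreover have "y = norm y *\<^sub>R x" "0 \<le> norm y" using M_D(1)[OF y] by (simp_all add: x_def)
    ultimately show "y \<in> cone_over (sphere_product l blk (minimal_radius l ks)) - {0}"
      unfolding cone_over_def using M_D(1)[OF y] by blast
  qed
qed

lemma M_borel: "M \<in> sets borel"
proof -
  have "M = (- {0}) \<inter> (\<Inter>i\<in>I. {x. P i x \<bullet> x = \<rho> i * (x \<bullet> x)})"
    by (auto simp: M_def q_eq_inner_P)
  moreover have "closed {x. P i x \<bullet> x = \<rho> i * (x \<bullet> x)}" for i
    by (intro closed_Collect_eq continuous_intros linear_continuous_on bounded_linear_P)
  then have "closed (\<Inter>i\<in>I. {x. P i x \<bullet> x = \<rho> i * (x \<bullet> x)})" by blast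
  ultimately show ?thesis by simp
qed

lemma subspace_T: "subspace (T x)"
  by (auto simp: subspace_def T_def q_linear inner_add_right algebra_simps)

lemma self_in_T: "p \<in> M \<Longrightarrow> p \<in> T p"
  by (simp add: T_def M_D)

text \<open>On tangent vectors each block form is \<open>\<rho> i\<close> times the full inner
  product, so the weighted sum of the \<open>c i\<close> factors out.\<close>

lemma D_orthogonal_T:
  assumes "(\<Sum>i\<in>I. c i * \<rho> i) = 0" "v \<in> T p" shows "D c p \<bullet> v = 0"
proof -
  have "D c p \<bullet> v = (\<Sum>i\<in>I. c i * \<rho> i) * (p \<bullet> v)"
    unfolding inner_D sum_distrib_right using assms(2) by (intro sum.cong) (simp_all add: T_def)
  then show ?thesis using assms(1) by simp
qed

lemma sum_N_coeff:
  assumes "p \<in> M"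
  shows "(\<Sum>i\<in>I. (q i p v / \<rho> i - p \<bullet> v) / (p \<bullet> p) * \<rho> i) = 0"
proof -
  have "(\<Sum>i\<in>I. (q i p v / \<rho> i - p \<bullet> v) / (p \<bullet> p) * \<rho> i) = (\<Sum>i\<in>I. (q i p v - \<rho> i * (p \<bullet> v)) / (p \<bullet> p))"
  proof (intro sum.cong refl)
    fix i assume "i \<in> I"
    then show "(q i p v / \<rho> i - p \<bullet> v) / (p \<bullet> p) * \<rho> i = (q i p v - \<rho> i * (p \<bullet> v)) / (p \<bullet> p)"
      using \<rho>_pos[of i] M_D(2)[OF assms] by (simp add: field_simps)
  qed
  also have "\<dots> = ((\<Sum>i\<in>I. q i p v) - (\<Sum>i\<in>I. \<rho> i) * (p \<bullet> v)) / (p \<bullet> p)"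
    by (simp add: sum_subtractf sum_distrib_right flip: sum_divide_distrib)
  also have "\<dots> = 0" by (simp add: sum_\<rho> inner_eq_sum_q)
  finally show ?thesis .
qed

lemma N_orthogonal_T: "p \<in> M \<Longrightarrow> v \<in> T p \<Longrightarrow> N p w \<bullet> v = 0"
  unfolding N_def by (rule D_orthogonal_T[OF sum_N_coeff])

lemma diff_N_in_T:
  assumes p: "p \<in> M" shows "v - N p v \<in> T p"
proof -
  have "p \<bullet> N p v = 0" using N_orthogonal_T[OF p self_in_T[OF p]] by (simp add: inner_commute)
  moreover have "q i p (N p v) = q i p v - \<rho> i * (p \<bullet> v)" if "i \<in> I" for i
    using M_D[OF p] that \<rho>_pos[OF that] by (simp add: N_def q_D_right field_simps)
  ultimately show ?thesis by (simp add: T_def q_linear inner_diff_right)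
qed

lemma linear_N: "linear (N p)"
  by (intro linearI)
     (simp_all add: N_def vec_eq_iff D_nth q_linear inner_add_right add_divide_distrib diff_divide_distrib algebra_simps)

lemma N_self_adjoint:
  assumes "p \<in> M" shows "N p v \<bullet> w = v \<bullet> N p w"
proof -
  have "N p v \<bullet> (w - N p w) = 0" "N p w \<bullet> (v - N p v) = 0"
    by (intro N_orthogonal_T diff_N_in_T assms)+
  then show ?thesis by (simp add: inner_diff_right inner_commute)
qed

lemma N_eq_0: "v \<in> T p \<Longrightarrow> N p v = 0"
proof -
  assume v: "v \<in> T p"
  have "N p v = D (\<lambda>i. 0) p" unfolding N_def
  proof (rule D_cong)
    fix i assume i: "i \<in> I"
    then have "q i p v = \<rho> i * (p \<bullet> v)" "\<rho> i \<noteq> 0" using v \<rho>_pos[OF i] by (auto simp: T_def)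
    then show "(q i p v / \<rho> i - p \<bullet> v) / (p \<bullet> p) = 0" by simp
  qed
  also have "\<dots> = 0" by (simp add: D_def vec_eq_iff)
  finally show ?thesis .
qed

end

text \<open>In block \<open>i\<close>, with \<open>u = U i\<close> the direction of \<open>P i p\<close>, the chart keeps the component
  orthogonal to \<open>u\<close> and replaces the component along \<open>u\<close> by \<open>\<bar>P i x\<bar>\<^sup>2 / \<rho> i\<close>; these numbers
  agree for all \<open>i\<close> exactly on the cone.\<close>

locale sphere_product_cone_chart = sphere_product_cone l k ks blk
  for l k :: nat and ks :: "nat \<Rightarrow> nat" and blk :: "'n::finite \<Rightarrow> nat" +
  fixes p :: "real ^ 'n"
  assumes p_in: "p \<in> M"
begin

definition U :: "nat \<Rightarrow> real ^ 'n" where "U i = (1 / sqrt (q i p p)) *\<^sub>R P i p"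

definition \<Phi> :: "real ^ 'n \<Rightarrow> real ^ 'n" where
  "\<Phi> x = x + (\<Sum>i\<in>I. (q i x x / \<rho> i - x \<bullet> U i) *\<^sub>R U i)"

text \<open>The squared component along \<open>U i\<close> of the point that \<open>\<Phi>\<close>
  sends to \<open>y\<close>, by Pythagoras: \<open>\<rho> i * (y \<bullet> U i)\<close> is the
  squared length of its block \<open>i\<close>, and
  \<open>q i y y - (y \<bullet> U i)\<^sup>2\<close> that of the part orthogonal to
  \<open>U i\<close>.\<close>

definition rad :: "nat \<Rightarrow> real ^ 'n \<Rightarrow> real" where
  "rad i y = \<rho> i * (y \<bullet> U i) - q i y y + (y \<bullet> U i)\<^sup>2"

definition \<Psi> :: "real ^ 'n \<Rightarrow> real ^ 'n" where
  "\<Psi> y = y + (\<Sum>i\<in>I. (sqrt (rad i y) - y \<bullet> U i) *\<^sub>R U i)"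

text \<open>Positive components along the \<open>U i\<close> can be recovered from their
  squares.\<close>

definition W :: "(real ^ 'n) set" where "W = {x. \<forall>i\<in>I. 0 < x \<bullet> U i}"
definition W' :: "(real ^ 'n) set" where "W' = {y. \<forall>i\<in>I. 0 < rad i y}"
definition S :: "(real ^ 'n) set" where "S = {y. \<forall>i\<in>I. y \<bullet> U i = y \<bullet> U 1}"

lemma inner_U: "i \<in> I \<Longrightarrow> y \<bullet> U i = q i p y / sqrt (q i p p)"
  by (simp add: U_def q_eq_inner_P inner_commute)

lemma q_U: "i \<in> I \<Longrightarrow> j \<in> I \<Longrightarrow> q i (U j) y = of_bool (i = j) * (y \<bullet> U i)"
  by (simp add: inner_U) (simp add: U_def q_linear P_def q_D)

lemma U_orthonormal: "i \<in> I \<Longrightarrow> j \<in> I \<Longrightarrow> U i \<bullet> U j = of_bool (i = j)"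
proof -
  assume ij: "i \<in> I" "j \<in> I"
  have "U i \<bullet> U j = q j (U i) p / sqrt (q j p p)" using ij by (simp add: inner_U q_commute)
  also have "\<dots> = of_bool (j = i) * (p \<bullet> U j) / sqrt (q j p p)" using ij by (simp add: q_U)
  also have "\<dots> = of_bool (i = j)" using M_D(4)[OF p_in ij(2)] ij by (simp add: inner_U)
  finally show ?thesis .
qed

lemma inner_add_U:
  assumes i: "i \<in> I"
  shows "(x + (\<Sum>j\<in>I. a j *\<^sub>R U j)) \<bullet> U i = x \<bullet> U i + a i"
proof -
  have "(\<Sum>j\<in>I. a j * (U j \<bullet> U i)) = (\<Sum>j\<in>I. if j = i then a j else 0)"
    by (rule sum.cong) (use i U_orthonormal in auto)
  then show ?thesis using i by (simp add: inner_add_left inner_sum_left)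
qed

lemma q_add_U:
  assumes i: "i \<in> I" and z: "z = x + (\<Sum>j\<in>I. a j *\<^sub>R U j)"
  shows "q i z z = q i x x + 2 * a i * (x \<bullet> U i) + (a i)\<^sup>2"
proof -
  have s: "q i (\<Sum>j\<in>I. a j *\<^sub>R U j) y = a i * (y \<bullet> U i)" for y
  proof -
    have "q i (\<Sum>j\<in>I. a j *\<^sub>R U j) y = (\<Sum>j\<in>I. if j = i then a j * (y \<bullet> U i) else 0)"
      unfolding q_sum by (rule sum.cong) (use i q_U in \<open>auto simp: q_linear\<close>)
    then show ?thesis using i by simp
  qed
  have "q i z z = q i x x + 2 * q i (\<Sum>j\<in>I. a j *\<^sub>R U j) x + q i (\<Sum>j\<in>I. a j *\<^sub>R U j) (\<Sum>j\<in>I. a j *\<^sub>R U j)"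
    using q_commute[of i x "\<Sum>j\<in>I. a j *\<^sub>R U j"] by (simp add: z q_linear)
  also have "q i (\<Sum>j\<in>I. a j *\<^sub>R U j) (\<Sum>j\<in>I. a j *\<^sub>R U j) = (a i)\<^sup>2"
    using inner_add_U[OF i, of 0 a] by (simp add: s power2_eq_square)
  finally show ?thesis by (simp add: s)
qed

lemma \<Phi>_inner_U: "i \<in> I \<Longrightarrow> \<Phi> x \<bullet> U i = q i x x / \<rho> i"
  unfolding \<Phi>_def by (simp add: inner_add_U)

lemma \<Psi>_inner_U: "i \<in> I \<Longrightarrow> \<Psi> y \<bullet> U i = sqrt (rad i y)"
  unfolding \<Psi>_def by (simp add: inner_add_U)

lemma rad_\<Phi>: "i \<in> I \<Longrightarrow> rad i (\<Phi> x) = (x \<bullet> U i)\<^sup>2"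
  using \<rho>_pos[of i] q_add_U[OF _ \<Phi>_def, of i x] \<Phi>_inner_U[of i x]
  by (simp add: rad_def power2_eq_square algebra_simps)

lemma q_\<Psi>: "i \<in> I \<Longrightarrow> 0 \<le> rad i y \<Longrightarrow> q i (\<Psi> y) (\<Psi> y) = \<rho> i * (y \<bullet> U i)"
proof -
  assume i: "i \<in> I" "0 \<le> rad i y"
  have "(sqrt (rad i y))\<^sup>2 = rad i y" using i by simp
  then show ?thesis using q_add_U[OF i(1) \<Psi>_def, of y]
    by (simp add: rad_def power2_eq_square algebra_simps)
qed

lemma \<Psi>_\<Phi>:
  assumes "x \<in> W" shows "\<Phi> x \<in> W'" "\<Psi> (\<Phi> x) = x"
proof -
  have pos: "0 < x \<bullet> U i" if "i \<in> I" for i using assms that by (simp add: W_def)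
  then show "\<Phi> x \<in> W'" by (auto simp: W'_def rad_\<Phi> less_imp_neq[OF pos, symmetric])
  have "(\<Sum>i\<in>I. (sqrt (rad i (\<Phi> x)) - \<Phi> x \<bullet> U i) *\<^sub>R U i) = (\<Sum>i\<in>I. - ((q i x x / \<rho> i - x \<bullet> U i) *\<^sub>R U i))"
  proof (rule sum.cong)
    fix i assume i: "i \<in> I"
    then show "(sqrt (rad i (\<Phi> x)) - \<Phi> x \<bullet> U i) *\<^sub>R U i = - ((q i x x / \<rho> i - x \<bullet> U i) *\<^sub>R U i)"
      using pos[OF i] by (simp add: rad_\<Phi> \<Phi>_inner_U flip: scaleR_minus_left)
  qed simp
  then show "\<Psi> (\<Phi> x) = x" unfolding \<Psi>_def[of "\<Phi> x"] sum_negf by (simp add: \<Phi>_def)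
qed

lemma \<Phi>_\<Psi>:
  assumes "y \<in> W'" shows "\<Psi> y \<in> W" "\<Phi> (\<Psi> y) = y"
proof -
  have pos: "0 < rad i y" if "i \<in> I" for i using assms that by (simp add: W'_def)
  then show "\<Psi> y \<in> W" by (simp add: W_def \<Psi>_inner_U)
  have "(\<Sum>i\<in>I. (q i (\<Psi> y) (\<Psi> y) / \<rho> i - \<Psi> y \<bullet> U i) *\<^sub>R U i) = (\<Sum>i\<in>I. - ((sqrt (rad i y) - y \<bullet> U i) *\<^sub>R U i))"
  proof (rule sum.cong)
    fix i assume i: "i \<in> I"
    then show "(q i (\<Psi> y) (\<Psi> y) / \<rho> i - \<Psi> y \<bullet> U i) *\<^sub>R U i = - ((sqrt (rad i y) - y \<bullet> U i) *\<^sub>R U i)"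
      using pos[OF i] \<rho>_pos[OF i] by (simp add: q_\<Psi> \<Psi>_inner_U flip: scaleR_minus_left)
  qed simp
  then show "\<Phi> (\<Psi> y) = y" unfolding \<Phi>_def[of "\<Psi> y"] sum_negf by (simp add: \<Psi>_def)
qed

lemma \<Phi>_in_S_iff: assumes "x \<in> W" shows "\<Phi> x \<in> S \<longleftrightarrow> x \<in> M"
proof
  assume S: "\<Phi> x \<in> S"
  define t where "t = \<Phi> x \<bullet> U 1"
  have q: "q i x x = \<rho> i * t" if "i \<in> I" for i
  proof -
    have "q i x x / \<rho> i = t" using S that unfolding S_def t_def by (simp add: \<Phi>_inner_U[symmetric])
    then show ?thesis using \<rho>_pos[OF that] by (simp add: field_simps)
  qed
  have "x \<bullet> x = (\<Sum>i\<in>I. \<rho> i) * t" unfolding inner_eq_sum_q sum_distrib_right by (rule sum.cong) (simp_all add: q)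
  then have "x \<bullet> x = t" by (simp add: sum_\<rho>)
  moreover have "x \<noteq> 0" using assms one_in_I by (auto simp: W_def)
  ultimately show "x \<in> M" using q by (simp add: M_def)
next
  assume "x \<in> M"
  then have "\<Phi> x \<bullet> U i = x \<bullet> x" if "i \<in> I" for i
    using that \<rho>_pos[OF that] by (simp add: \<Phi>_inner_U M_D)
  then show "\<Phi> x \<in> S" using one_in_I by (simp add: S_def)
qed

lemma p_in_W: "p \<in> W"
  using M_D[OF p_in] by (simp add: W_def inner_U)

lemma subspace_S: "subspace S"
  by (auto simp: subspace_def S_def inner_add_left)

text \<open>The \<open>l\<close> orthonormal vectors \<open>U i\<close> have a complement
  \<open>S0\<close> of dimension \<open>n - l\<close>, and \<open>S\<close> exceeds it by one
  direction. Since \<open>n = l + (k - 1)\<close>, the dimension is \<open>k\<close>.\<close>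

lemma dim_S: "dim S = k"
proof -
  define S0 where "S0 = {y. \<forall>i\<in>I. y \<bullet> U i = 0}"
  \<comment> \<open>All its components along the \<open>U i\<close> are 1, so it satisfies the
    equations of \<open>S\<close> but lies outside \<open>S0\<close>.\<close>
  define w where "w = (\<Sum>j\<in>I. U j)"
  have wU: "w \<bullet> U i = 1" if "i \<in> I" for i
    using inner_add_U[OF that, of 0 "\<lambda>_. 1"] by (simp add: w_def)
  have inj: "inj_on U I"
    using U_orthonormal by (auto simp: inj_on_def) (metis of_bool_eq_1_iff)
  have ind: "independent (U ` I)"
  proof (rule pairwise_orthogonal_independent)
    show "pairwise orthogonal (U ` I)" using U_orthonormal by (auto simp: pairwise_def orthogonal_def)
    show "0 \<notin> U ` I" using U_orthonormal by (auto simp: image_iff) (metis inner_zero_left of_bool_eq_0_iff)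
  qed
  have "dim (U ` I) = l" using dim_eq_card_independent[OF ind] card_image[OF inj] card_I by simp
  then have dl: "dim (span (U ` I)) = l" by simp
  have "S0 = {y \<in> UNIV. \<forall>x\<in>span (U ` I). orthogonal x y}"
  proof (intro set_eqI iffI)
    fix y assume y: "y \<in> S0"
    have "orthogonal y x" if "x \<in> span (U ` I)" for x
      by (rule orthogonal_to_span[OF that]) (use y in \<open>auto simp: S0_def orthogonal_def\<close>)
    then show "y \<in> {y \<in> UNIV. \<forall>x\<in>span (U ` I). orthogonal x y}" by (simp add: orthogonal_commute)
  next
    fix y assume "y \<in> {y \<in> UNIV. \<forall>x\<in>span (U ` I). orthogonal x y}"
    then show "y \<in> S0" using span_base[of _ "U ` I"] by (auto simp: S0_def orthogonal_def inner_commute)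
  qed
  then have dS0: "dim S0 + l = CARD('n)"
    using dim_subspace_orthogonal_to_vectors[of "span (U ` I)" UNIV] dl by simp
  have sub0: "subspace S0" by (auto simp: subspace_def S0_def inner_add_left)
  have "w \<notin> S0" using wU one_in_I by (auto simp: S0_def)
  then have "w \<notin> span S0" using sub0 by (simp add: span_eq_iff[THEN iffD2])
  then have "dim (insert w S0) = dim S0 + 1" by (simp add: dim_insert)
  moreover have "span (insert w S0) = S"
  proof
    show "span (insert w S0) \<subseteq> S"
      by (rule span_minimal[OF _ subspace_S]) (use wU one_in_I in \<open>auto simp: S_def S0_def\<close>)
    show "S \<subseteq> span (insert w S0)"
    proof
      fix y assume y: "y \<in> S"
      have "y - (y \<bullet> U 1) *\<^sub>R w \<in> S0"
        using y wU by (simp add: S_def S0_def inner_diff_left)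
      then have "y - (y \<bullet> U 1) *\<^sub>R w \<in> span (insert w S0)" by (simp add: span_base)
      moreover have "(y \<bullet> U 1) *\<^sub>R w \<in> span (insert w S0)" by (intro span_scale span_base) simp
      ultimately show "y \<in> span (insert w S0)" using span_add by fastforce
    qed
  qed
  ultimately have "dim S = dim S0 + 1" by (metis dim_span)
  moreover have "CARD('n) = l + (\<Sum>i=1..l. ks i)"
  proof -
    have "(\<Sum>i\<in>I. sum (\<lambda>a. 1) {a \<in> UNIV. blk a = i}) = (\<Sum>a\<in>(UNIV :: 'n set). 1 :: nat)"
      by (rule sum.group) (use blk_in in \<open>auto simp: I_def\<close>)
    then have "CARD('n) = (\<Sum>i=1..l. card {a. blk a = i})" by (simp add: I_def)
    also have "\<dots> = (\<Sum>i=1..l. ks i + 1)" by (rule sum.cong) (use card_blk in auto)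
    also have "\<dots> = l + (\<Sum>i=1..l. ks i)" by (subst sum.distrib) simp
    finally show ?thesis .
  qed
  ultimately show ?thesis using dS0 k_eq by linarith
qed

lemma C2_q: "i \<in> I \<Longrightarrow> C2_on A (\<lambda>x. q i x x)"
  by (intro bounded_bilinear.C2_on_prod[OF bounded_bilinear_q] C2_on_bounded_linear bounded_linear_ident)

lemma C2_inner_U: "C2_on A (\<lambda>x. x \<bullet> U i)"
  by (intro C2_on_bounded_linear bounded_linear_inner_left)

lemma C2_scaleR_U: "C2_on A f \<Longrightarrow> C2_on A (\<lambda>x. f x *\<^sub>R U i)"
  by (rule bounded_bilinear.C2_on_prod[OF bounded_bilinear_scaleR _ C2_on_const])

lemma C2_rad: "i \<in> I \<Longrightarrow> C2_on A (rad i)"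
  unfolding rad_def[abs_def] power2_eq_square
  by (intro C2_on_add C2_on_diff C2_on_mult C2_q C2_inner_U C2_on_const)

lemma C2_\<Phi>: "C2_on W \<Phi>"
  unfolding \<Phi>_def[abs_def] divide_inverse
  by (intro C2_on_add C2_on_sum C2_scaleR_U C2_on_diff C2_on_mult C2_q C2_inner_U C2_on_const
      C2_on_bounded_linear bounded_linear_ident)

lemma C2_\<Psi>: "C2_on W' \<Psi>"
  unfolding \<Psi>_def[abs_def]
  by (intro C2_on_add C2_on_sum C2_scaleR_U C2_on_diff C2_inner_U
      C2_on_bounded_linear bounded_linear_ident C2_on_compose[OF C2_on_sqrt C2_rad])
     (auto simp: W'_def)

lemma open_W: "open W" and open_W': "open W'"
proof -
  have W: "W = (\<Inter>i\<in>I. {x. 0 < x \<bullet> U i})" "W' = (\<Inter>i\<in>I. {x. 0 < rad i x})" by (auto simp: W_def W'_def)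
  have "continuous_on UNIV (rad i)" if "i \<in> I" for i
    by (rule C1_on_imp_continuous_on[OF C2_on_imp_C1_on[OF C2_rad[OF that]]])
  then have "open {x. 0 < rad i x}" if "i \<in> I" for i
    using that by (intro open_Collect_less) auto
  then show "open W'" unfolding W by (intro open_INT) auto
  show "open W" unfolding W by (intro open_INT ballI open_Collect_less continuous_intros) auto
qed

lemma \<Phi>_image: "\<Phi> ` W = W'" "\<Psi> ` W' = W" "\<Phi> ` (M \<inter> W) = S \<inter> W'"
proof -
  show "\<Phi> ` W = W'" "\<Psi> ` W' = W" using \<Psi>_\<Phi> \<Phi>_\<Psi> by (auto simp: image_iff) metis+
  show "\<Phi> ` (M \<inter> W) = S \<inter> W'"
  proof (intro set_eqI iffI)
    fix y assume "y \<in> S \<inter> W'"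
    then have "\<Psi> y \<in> M \<inter> W" "y = \<Phi> (\<Psi> y)" using \<Phi>_\<Psi>[of y] \<Phi>_in_S_iff[of "\<Psi> y"] by auto
    then show "y \<in> \<Phi> ` (M \<inter> W)" by (metis imageI)
  qed (use \<Psi>_\<Phi> \<Phi>_in_S_iff in auto)
qed

text \<open>For \<open>v\<close> in \<open>T p\<close> the derivative of the chart has the same
  component \<open>2 * (p \<bullet> v)\<close> along every \<open>U i\<close>; it thus points into
  \<open>S\<close>.\<close>

lemma T_subset_tan_space: assumes v: "v \<in> T p" shows "v \<in> tan_space M p"
proof -
  define L where "L v = v + (\<Sum>i\<in>I. (2 * q i p v / \<rho> i - v \<bullet> U i) *\<^sub>R U i)" for v
  have dq: "((\<lambda>x. q i x x) has_derivative (\<lambda>v. 2 * q i p v)) (at p)" if "i \<in> I" for i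
    using bounded_bilinear.FDERIV[OF bounded_bilinear_q[OF that] has_derivative_ident has_derivative_ident, of p UNIV]
    by (simp add: q_commute[of i _ p])
  have "(\<Phi> has_derivative L) (at p)"
    unfolding \<Phi>_def[abs_def] L_def[abs_def]
  proof (intro has_derivative_add has_derivative_ident has_derivative_sum has_derivative_scaleR_left has_derivative_diff)
    fix i assume i: "i \<in> I"
    show "((\<lambda>x. q i x x / \<rho> i) has_derivative (\<lambda>v. 2 * q i p v / \<rho> i)) (at p)"
      using has_derivative_mult_left[OF dq[OF i], of "inverse (\<rho> i)"] by (simp add: divide_inverse)
    show "((\<lambda>x. x \<bullet> U i) has_derivative (\<lambda>v. v \<bullet> U i)) (at p)"
      by (intro bounded_linear_imp_has_derivative bounded_linear_inner_left)
  qed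
  moreover have "L v \<in> S"
  proof -
    have "L v \<bullet> U i = 2 * (p \<bullet> v)" if "i \<in> I" for i
      using inner_add_U[OF that, of v "\<lambda>i. 2 * q i p v / \<rho> i - v \<bullet> U i"] v \<rho>_pos[OF that] that
      by (simp add: L_def T_def)
    then show ?thesis using one_in_I by (simp add: S_def)
  qed
  moreover have "\<Psi> ` (S \<inter> W') \<subseteq> M"
  proof (intro image_subsetI)
    fix y assume "y \<in> S \<inter> W'"
    then show "\<Psi> y \<in> M" using \<Phi>_\<Psi>[of y] \<Phi>_in_S_iff[of "\<Psi> y"] by simp
  qed
  moreover have "\<Phi> p \<in> S" using \<Phi>_in_S_iff p_in_W p_in by blast
  ultimately show ?thesis
    using \<Phi>_image(1) \<Psi>_\<Phi>(2)
    by (intro chart_velocity_in_tan_space[OF open_W p_in_W open_W' C2_on_imp_C1_on[OF C2_\<Psi>],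
          where \<Phi> = \<Phi> and L = L and S = S] subspace_S) auto
qed

end

section \<open>Tangent and normal spaces of the cone\<close>

context sphere_product_cone begin

lemma C2_submanifold_M: "C2_submanifold k M"
  unfolding C2_submanifold_def
proof
  fix p assume "p \<in> M"
  then interpret sphere_product_cone_chart l k ks blk p by unfold_locales
  show "\<exists>W W' S (\<Phi> :: real ^ 'n \<Rightarrow> real ^ 'n) (\<Psi> :: real ^ 'n \<Rightarrow> real ^ 'n).
        open W \<and> p \<in> W \<and> open W' \<and> C2_on W \<Phi> \<and> C2_on W' \<Psi> \<and>
        \<Phi> ` W = W' \<and> \<Psi> ` W' = W \<and> (\<forall>x\<in>W. \<Psi> (\<Phi> x) = x) \<and> (\<forall>y\<in>W'. \<Phi> (\<Psi> y) = y) \<and>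
        subspace S \<and> dim S = k \<and> \<Phi> ` (M \<inter> W) = S \<inter> W'"
    by (rule exI[of _ W], rule exI[of _ W'], rule exI[of _ S], rule exI[of _ \<Phi>], rule exI[of _ \<Psi>])
       (simp add: open_W p_in_W open_W' C2_\<Phi> C2_\<Psi> \<Phi>_image \<Psi>_\<Phi> \<Phi>_\<Psi> subspace_S dim_S)
qed

lemma tan_space_M: assumes p: "p \<in> M" shows "tan_space M p = T p"
proof
  interpret sphere_product_cone_chart l k ks blk p using p by unfold_locales
  show "T p \<subseteq> tan_space M p" using T_subset_tan_space by blast
  show "tan_space M p \<subseteq> T p"
  proof
    fix v assume "v \<in> tan_space M p"
    then obtain \<gamma> \<epsilon> where g: "0 < \<epsilon>" "\<gamma> ` {-\<epsilon><..<\<epsilon>} \<subseteq> M" "\<gamma> 0 = p" "(\<gamma> has_vector_derivative v) (at 0)"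
      unfolding tan_space_def by blast
    \<comment> \<open>The two sides of the \<open>i\<close>-th equation of \<open>M\<close> agree
      along the curve, hence so do their derivatives at 0.\<close>
    have "q i p v = \<rho> i * (p \<bullet> v)" if i: "i \<in> I" for i
    proof -
      have dq: "((\<lambda>x. q i x x) has_derivative (\<lambda>v. 2 * q i p v)) (at p within M)"
        using bounded_bilinear.FDERIV[OF bounded_bilinear_q[OF i] has_derivative_ident has_derivative_ident, of p M]
        by (simp add: q_commute[of i _ p])
      have di: "((\<lambda>x. \<rho> i * (x \<bullet> x)) has_derivative (\<lambda>v. \<rho> i * (2 * (p \<bullet> v)))) (at p within M)"
        by (auto intro!: derivative_eq_intros simp: inner_commute)
      have "((\<lambda>t. q i (\<gamma> t) (\<gamma> t)) has_vector_derivative \<rho> i * (2 * (p \<bullet> v))) (at 0)"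
      proof (rule has_vector_derivative_transform_within_open[OF has_derivative_within_curve[OF di g]])
        show "\<rho> i * (\<gamma> t \<bullet> \<gamma> t) = q i (\<gamma> t) (\<gamma> t)" if "t \<in> {-\<epsilon><..<\<epsilon>}" for t
          using M_D(3)[of "\<gamma> t"] g(2) that i by (auto simp: image_subset_iff)
      qed (use g(1) in auto)
      from vector_derivative_unique_at[OF this has_derivative_within_curve[OF dq g]] show ?thesis by simp
    qed
    then show "v \<in> T p" by (simp add: T_def)
  qed
qed

lemma N_in_normal_space: "p \<in> M \<Longrightarrow> N p v \<in> normal_space M p"
  using N_orthogonal_T[of p] by (auto simp: normal_space_def tan_space_M inner_commute[of _ "N p v"])

lemma nproj_M: assumes p: "p \<in> M" shows "nproj M p v = N p v"
  unfolding nproj_def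
proof (rule the_equality)
  show "N p v \<in> normal_space M p \<and> v - N p v \<in> tan_space M p"
    using p by (simp add: N_in_normal_space tan_space_M diff_N_in_T)
  fix w assume w: "w \<in> normal_space M p \<and> v - w \<in> tan_space M p"
  have "(v - N p v) - (v - w) \<in> T p"
    using w p by (intro subspace_diff[OF subspace_T diff_N_in_T[OF p]]) (simp add: tan_space_M)
  then have t: "w - N p v \<in> T p" by simp
  then have "(w - N p v) \<bullet> w = 0" using w p by (simp add: normal_space_def tan_space_M)
  moreover have "(w - N p v) \<bullet> N p v = 0" using N_orthogonal_T[OF p t] by (simp add: inner_commute)
  ultimately have "(w - N p v) \<bullet> (w - N p v) = 0" by (simp add: inner_diff_right)
  then show "w = N p v" by simp
qed

lemma N_normal: assumes p: "p \<in> M" and w: "w \<in> normal_space M p" shows "N p w = w"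
proof -
  have "w - N p w \<in> T p" by (rule diff_N_in_T[OF p])
  then have "(w - N p w) \<bullet> w = 0" "(w - N p w) \<bullet> N p w = 0"
    using w p N_orthogonal_T[OF p] by (auto simp: normal_space_def tan_space_M inner_commute[of "w - N p w" "N p w"])
  then have "(w - N p w) \<bullet> (w - N p w) = 0" by (simp add: inner_diff_right)
  then show ?thesis by simp
qed

end

section \<open>Second fundamental form of the cone\<close>

context sphere_product_cone begin

lemma tan_frame_M:
  assumes p: "p \<in> M"
  shows "finite (tan_frame M p)" "pairwise orthogonal (tan_frame M p)"
    "\<And>e. e \<in> tan_frame M p \<Longrightarrow> norm e = 1" "\<And>e. e \<in> tan_frame M p \<Longrightarrow> e \<in> T p"
    "span (tan_frame M p) = T p"
proof -
  have ex: "\<exists>E. pairwise orthogonal E \<and> (\<forall>e\<in>E. norm e = 1) \<and> E \<subseteq> tan_space M p \<and> span E = tan_space M p"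
    unfolding tan_space_M[OF p] using orthonormal_basis_subspace[OF subspace_T[of p]] by metis
  note E = someI_ex[OF ex, folded tan_frame_def, unfolded tan_space_M[OF p]]
  show o: "pairwise orthogonal (tan_frame M p)" and n: "\<And>e. e \<in> tan_frame M p \<Longrightarrow> norm e = 1"
    and "\<And>e. e \<in> tan_frame M p \<Longrightarrow> e \<in> T p" and "span (tan_frame M p) = T p"
    using E by auto
  have "0 \<notin> tan_frame M p" using n by force
  then show "finite (tan_frame M p)" using pairwise_orthogonal_independent[OF o] independent_imp_finite by blast
qed

text \<open>Parseval for the tangential part of \<open>w\<close>. It frees sums over the arbitrarily
  chosen frame from that choice.\<close>

lemma tan_frame_sum_inner_squares:
  assumes p: "p \<in> M"
  shows "(\<Sum>e\<in>tan_frame M p. (e \<bullet> w)\<^sup>2) = w \<bullet> w - N p w \<bullet> w"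
proof -
  note E = tan_frame_M[OF p]
  have "(\<Sum>e\<in>tan_frame M p. (e \<bullet> w)\<^sup>2) = (\<Sum>e\<in>tan_frame M p. (e \<bullet> (w - N p w))\<^sup>2)"
    using E(4) N_orthogonal_T[OF p] by (intro sum.cong) (auto simp: inner_diff_right inner_commute[of _ "N p w"])
  also have "\<dots> = (w - N p w) \<bullet> (w - N p w)"
    using E diff_N_in_T[OF p] by (intro orthonormal_sum_inner_squares) auto
  also have "\<dots> = w \<bullet> w - N p w \<bullet> w"
    using N_orthogonal_T[OF p diff_N_in_T[OF p], of w w] by (simp add: inner_diff_left inner_diff_right inner_commute)
  finally show ?thesis .
qed

text \<open>The block form is summed over the coordinate axes of its block: each of the
  \<open>ks i + 1\<close> axes contributes 1 minus its normal part, and the normal parts add up to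
  \<open>1 - \<rho> i\<close>.\<close>

lemma tan_frame_trace_q:
  assumes p: "p \<in> M" and i: "i \<in> I"
  shows "(\<Sum>e\<in>tan_frame M p. q i e e) = real (ks i) + \<rho> i"
proof -
  have N_axis: "N p (axis a 1) \<bullet> axis a 1 = (1 / \<rho> i - 1) / (p \<bullet> p) * (p $ a * p $ a)" if a: "blk a = i" for a
  proof -
    have "q i p (axis a 1) = p $ a"
      using a by (simp add: q_def axis_def if_distrib[of "\<lambda>c. _ * c"] cong: if_cong)
    then show ?thesis
      using M_D[OF p] a by (simp add: inner_axis N_def D_nth field_simps)
  qed
  have "(\<Sum>e\<in>tan_frame M p. q i e e) = (\<Sum>a | blk a = i. \<Sum>e\<in>tan_frame M p. (e \<bullet> axis a 1)\<^sup>2)"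
    unfolding q_def by (subst sum.swap) (simp add: inner_axis power2_eq_square)
  also have "\<dots> = (\<Sum>a | blk a = i. 1 - (1 / \<rho> i - 1) / (p \<bullet> p) * (p $ a * p $ a))"
    by (rule sum.cong) (auto simp: tan_frame_sum_inner_squares[OF p] N_axis inner_axis_axis)
  also have "\<dots> = real (card {a. blk a = i}) - (1 / \<rho> i - 1) / (p \<bullet> p) * q i p p"
    unfolding sum_subtractf q_def sum_distrib_left by simp
  also have "(1 / \<rho> i - 1) / (p \<bullet> p) * q i p p = 1 - \<rho> i"
    using M_D[OF p] i \<rho>_pos[OF i] by (simp add: field_simps)
  finally show ?thesis using card_blk i by (simp add: I_def)
qed

lemma continuous_on_N:
  assumes "A \<subseteq> - {0}" and w: "continuous_on A w"
  shows "continuous_on A (\<lambda>x. N x (w x))"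
proof -
  have "continuous_on A (\<lambda>x. q i x (w x))" for i
    unfolding q_def using w by (intro continuous_intros continuous_on_component) auto
  then show ?thesis
    unfolding N_def D_eq_sum_P using assms
    by (intro continuous_intros bounded_linear.continuous_on[OF bounded_linear_P]) (auto dest: \<rho>_pos)
qed

text \<open>This tangential projection of a constant vector is the test field that realises the
  second fundamental form in \<open>sff_M\<close>.\<close>

lemma C1_on_diff_N: "C1_on (- {0}) (\<lambda>x. v - N x v)"
proof -
  have q: "C1_on (- {0}) (\<lambda>x. q i x v)" if "i \<in> I" for i
    using that by (intro C1_on_bounded_linear bounded_bilinear.bounded_linear_left[OF bounded_bilinear_q])
  have inn: "C1_on (- {0}) (\<lambda>x. x \<bullet> v)" by (intro C1_on_bounded_linear bounded_linear_inner_left)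
  have id: "C1_on (- {0}) (\<lambda>x::real ^ 'n. x)" by (intro C1_on_bounded_linear bounded_linear_ident)
  have inv: "C1_on (- {0}) (\<lambda>x::real ^ 'n. inverse (x \<bullet> x))"
    by (rule C1_on_compose[OF C1_on_inverse bounded_bilinear.C1_on_prod[OF bounded_bilinear_inner id id]]) auto
  have mult: "C1_on (- {0}) (\<lambda>x. f x * g x)" if "C1_on (- {0}) f" "C1_on (- {0}) g" for f g :: "real ^ 'n \<Rightarrow> real"
    using bounded_bilinear.C1_on_prod[OF bounded_bilinear_mult] that by blast
  have "C1_on (- {0}) (\<lambda>x. v + (\<Sum>i\<in>I. ((q i x v * - inverse (\<rho> i) + x \<bullet> v) * inverse (x \<bullet> x)) *\<^sub>R P i x))"
    by (intro C1_on_add C1_on_const C1_on_sum bounded_bilinear.C1_on_prod[OF bounded_bilinear_scaleR]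
        mult inv inn q C1_on_bounded_linear bounded_linear_P)
  moreover have "v - N x v = v + (\<Sum>i\<in>I. ((q i x v * - inverse (\<rho> i) + x \<bullet> v) * inverse (x \<bullet> x)) *\<^sub>R P i x)" for x
  proof -
    have "- N x v = (\<Sum>i\<in>I. - (((q i x v / \<rho> i - x \<bullet> v) / (x \<bullet> x)) *\<^sub>R P i x))"
      unfolding N_def D_eq_sum_P by (simp only: sum_negf)
    also have "\<dots> = (\<Sum>i\<in>I. ((q i x v * - inverse (\<rho> i) + x \<bullet> v) * inverse (x \<bullet> x)) *\<^sub>R P i x)"
      by (intro sum.cong refl) (simp add: divide_inverse algebra_simps flip: scaleR_minus_left)
    finally show ?thesis by (simp only: diff_conv_add_uminus)
  qed
  ultimately show ?thesis by (simp only:)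
qed

text \<open>The second fundamental form for tangent \<open>u\<close>, \<open>v\<close>. The
  coefficients are minus those of \<open>N\<close>, with \<open>u\<close> in place of the base point
  in the numerators: the product rule shifts the derivative from the field to the base
  point.\<close>

definition B :: "real ^ 'n \<Rightarrow> real ^ 'n \<Rightarrow> real ^ 'n \<Rightarrow> real ^ 'n" where
  "B p u v = D (\<lambda>i. - ((q i u v / \<rho> i - u \<bullet> v) / (p \<bullet> p))) p"

text \<open>Differentiating the equations \<open>q i x (V x) = \<rho> i * (x \<bullet> V x)\<close> of a tangent field along \<open>u\<close>
  determines the normal part of \<open>D\<^sub>u V\<close>.\<close>

lemma normal_derivative_tangent_field:
  assumes p: "p \<in> M" and u: "u \<in> T p" and W: "open W" "p \<in> W"
    and V: "C1_along (M \<inter> W) V" "\<And>x. x \<in> M \<inter> W \<Longrightarrow> V x \<in> tan_space M x"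
  shows "N p (flat_deriv M V p u) = B p u (V p)"
proof -
  have pW: "p \<in> M \<inter> W" using p W by simp
  have at: "at p within M \<inter> W = at p within M" by (rule at_within_nhd[of _ W]) (use W in auto)
  obtain L where V': "(V has_derivative L) (at p within M)"
    using C1_along_local_extension[OF V(1) pW] pW at by (metis IntI)
  have uM: "u \<in> tan_space M p" using u p by (simp add: tan_space_M)
  have d: "flat_deriv M V p u = L u" by (rule flat_deriv_eqI[OF V' uM])
  have eq: "q i u (V p) + q i p (L u) = \<rho> i * (u \<bullet> V p + p \<bullet> L u)" if i: "i \<in> I" for i
  proof -
    have 1: "((\<lambda>x. q i x (V x)) has_derivative (\<lambda>h. q i p (L h) + q i h (V p))) (at p within M)"
      by (rule bounded_bilinear.FDERIV[OF bounded_bilinear_q[OF i] has_derivative_ident V'])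
    have "((\<lambda>x. x \<bullet> V x) has_derivative (\<lambda>h. p \<bullet> L h + h \<bullet> V p)) (at p within M)"
      by (rule bounded_bilinear.FDERIV[OF bounded_bilinear_inner has_derivative_ident V'])
    then have 2: "((\<lambda>x. \<rho> i * (x \<bullet> V x)) has_derivative (\<lambda>h. \<rho> i * (p \<bullet> L h + h \<bullet> V p))) (at p within M)"
      by (rule has_derivative_mult_right)
    have "((\<lambda>x. q i x (V x)) has_derivative (\<lambda>h. \<rho> i * (p \<bullet> L h + h \<bullet> V p))) (at p within M \<inter> W)"
    proof (rule has_derivative_transform[OF pW _ 2[folded at]])
      fix x assume "x \<in> M \<inter> W"
      then show "q i x (V x) = \<rho> i * (x \<bullet> V x)" using V(2)[of x] i by (simp add: tan_space_M T_def)
    qed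
    then have 3: "((\<lambda>x. q i x (V x)) has_derivative (\<lambda>h. \<rho> i * (p \<bullet> L h + h \<bullet> V p))) (at p within M)"
      by (simp add: at)
    show ?thesis using tangential_derivative_unique[OF 1 3 uM] by (simp add: add.commute)
  qed
  show ?thesis unfolding d N_def B_def
  proof (rule D_cong)
    fix i assume i: "i \<in> I"
    have "q i p (L u) = \<rho> i * (u \<bullet> V p + p \<bullet> L u) - q i u (V p)" using eq[OF i] by linarith
    then have "q i p (L u) / \<rho> i - p \<bullet> L u = - (q i u (V p) / \<rho> i - u \<bullet> V p)"
      using \<rho>_pos[OF i] by (simp add: diff_divide_distrib)
    then show "(q i p (L u) / \<rho> i - p \<bullet> L u) / (p \<bullet> p) = - ((q i u (V p) / \<rho> i - u \<bullet> V p) / (p \<bullet> p))"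
      by (simp only: minus_divide_left)
  qed
qed

lemma sff_M:
  assumes p: "p \<in> M" and u: "u \<in> T p" and v: "v \<in> T p"
  shows "sff M p u v = B p u v"
  unfolding sff_def
proof (rule the_equality)
  define V where "V x = v - N x v" for x
  have V: "C1_along (M \<inter> UNIV) V" unfolding C1_along_def
  proof
    fix x assume "x \<in> M \<inter> UNIV"
    then show "\<exists>W Z. open W \<and> x \<in> W \<and> C1_on W Z \<and> (\<forall>y\<in>M \<inter> UNIV \<inter> W. V y = Z y)"
      using C1_on_diff_N[of v] M_D(1)[of x]
      by (intro exI[of _ "- {0}"] exI[of _ V]) (auto simp: V_def[abs_def])
  qed
  have Vt: "\<And>x. x \<in> M \<inter> UNIV \<Longrightarrow> V x \<in> tan_space M x"
    using diff_N_in_T by (simp add: V_def tan_space_M)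
  have Vp: "V p = v" by (simp add: V_def N_eq_0[OF v])
  have "B p u v = nproj M p (flat_deriv M V p u)"
    using normal_derivative_tangent_field[OF p u open_UNIV _ V Vt] Vp by (simp add: nproj_M p)
  then show "\<exists>V W. open W \<and> p \<in> W \<and> C1_along (M \<inter> W) V \<and> (\<forall>x\<in>M \<inter> W. V x \<in> tan_space M x) \<and>
      V p = v \<and> B p u v = nproj M p (flat_deriv M V p u)"
    using V Vt Vp by (intro exI[of _ V] exI[of _ UNIV]) auto
  fix b assume "\<exists>V W. open W \<and> p \<in> W \<and> C1_along (M \<inter> W) V \<and> (\<forall>x\<in>M \<inter> W. V x \<in> tan_space M x) \<and>
      V p = v \<and> b = nproj M p (flat_deriv M V p u)"
  then obtain V W where "open W" "p \<in> W" "C1_along (M \<inter> W) V" "\<forall>x\<in>M \<inter> W. V x \<in> tan_space M x"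
      "V p = v" "b = nproj M p (flat_deriv M V p u)"
    by (elim exE conjE)
  then show "b = B p u v"
    using normal_derivative_tangent_field[OF p u, of W V] by (simp add: nproj_M p)
qed

text \<open>The \<open>i\<close>-th block form has trace \<open>\<rho> i * k\<close> and the inner
  product has trace \<open>k\<close>, so every block coefficient of the summed
  \<open>B p e e\<close> cancels.\<close>

lemma mean_curv_M:
  assumes p: "p \<in> M" shows "mean_curv M p = 0"
proof -
  let ?E = "tan_frame M p"
  note E = tan_frame_M[OF p]
  have tr: "(\<Sum>e\<in>?E. e \<bullet> e) = real k"
  proof -
    have "(\<Sum>e\<in>?E. e \<bullet> e) = (\<Sum>i\<in>I. \<Sum>e\<in>?E. q i e e)"
      unfolding inner_eq_sum_q by (rule sum.swap)
    also have "\<dots> = (\<Sum>i\<in>I. \<rho> i * (real k - 1) + \<rho> i)"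
      by (rule sum.cong) (simp_all add: tan_frame_trace_q[OF p] \<rho>_mult)
    also have "\<dots> = (\<Sum>i\<in>I. \<rho> i) * real k"
      unfolding sum_distrib_right by (rule sum.cong) (simp_all add: algebra_simps)
    finally show ?thesis by (simp add: sum_\<rho>)
  qed
  have zero: "(\<Sum>e\<in>?E. - ((q i e e / \<rho> i - e \<bullet> e) / (p \<bullet> p))) = 0" if i: "i \<in> I" for i
  proof -
    have "(\<Sum>e\<in>?E. - ((q i e e / \<rho> i - e \<bullet> e) / (p \<bullet> p)))
       = - (((\<Sum>e\<in>?E. q i e e) / \<rho> i - (\<Sum>e\<in>?E. e \<bullet> e)) / (p \<bullet> p))"
      by (simp add: sum_negf sum_subtractf flip: sum_divide_distrib)
    also have "(\<Sum>e\<in>?E. q i e e) / \<rho> i = real k"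
      using \<rho>_pos[OF i] \<rho>_mult[of i] tan_frame_trace_q[OF p i] by (simp add: field_simps)
    finally show ?thesis by (simp add: tr)
  qed
  have "mean_curv M p = (\<Sum>e\<in>?E. B p e e)"
    unfolding mean_curv_def using E(4) by (intro sum.cong) (auto simp: sff_M[OF p])
  also have "\<dots> = D (\<lambda>i. \<Sum>e\<in>?E. - ((q i e e / \<rho> i - e \<bullet> e) / (p \<bullet> p))) p"
    by (simp only: B_def vec_eq_iff D_nth sum_component sum_distrib_right simp_thms)
  also have "\<dots> = D (\<lambda>i. 0) p" by (rule D_cong) (rule zero)
  finally show ?thesis by (simp add: D_def vec_eq_iff)
qed

text \<open>With \<open>X = D c p\<close>, the shape operator is, up to sign, the tangential part of
  \<open>D c\<close>. The squares of \<open>D c\<close> have trace \<open>\<Gamma> * k\<close> on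
  the tangent space; the normal part of \<open>D c\<close> takes away one \<Gamma>, because
  \<open>D c\<close> maps \<open>p\<close> to the normal vector \<open>X\<close>.\<close>

lemma sum_sff_squares:
  assumes p: "p \<in> M" and X: "X \<in> normal_space M p"
  shows "(\<Sum>u\<in>tan_frame M p. \<Sum>v\<in>tan_frame M p. (sff M p u v \<bullet> X)\<^sup>2) = (real k - 1) * (X \<bullet> X) / (p \<bullet> p)"
proof -
  let ?E = "tan_frame M p"
  note E = tan_frame_M[OF p]
  define c where "c i = (q i p X / \<rho> i - p \<bullet> X) / (p \<bullet> p)" for i
  define \<Gamma> where "\<Gamma> = (\<Sum>i\<in>I. (c i)\<^sup>2 * \<rho> i)"
  have Xc: "X = D c p" using N_normal[OF p X] by (simp add: N_def c_def[abs_def])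
  have c0: "(\<Sum>i\<in>I. c i * \<rho> i) = 0" using sum_N_coeff[OF p] by (simp add: c_def)
  have XX: "X \<bullet> X = \<Gamma> * (p \<bullet> p)"
    unfolding Xc inner_D \<Gamma>_def sum_distrib_right
    by (rule sum.cong) (simp_all add: q_D_right M_D[OF p] power2_eq_square)
  have BX: "B p u v \<bullet> X = - (v \<bullet> D c u)" for u v
  proof -
    have "B p u v \<bullet> X = (\<Sum>i\<in>I. c i * \<rho> i * (u \<bullet> v) - c i * q i u v)"
      unfolding Xc B_def inner_D
    proof (rule sum.cong)
      fix i assume i: "i \<in> I"
      show "- ((q i u v / \<rho> i - u \<bullet> v) / (p \<bullet> p)) * q i p (D c p) = c i * \<rho> i * (u \<bullet> v) - c i * q i u v"
        using M_D(2,3)[OF p] i \<rho>_pos[OF i] by (simp add: q_D_right field_simps)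
    qed simp
    also have "\<dots> = (\<Sum>i\<in>I. c i * \<rho> i) * (u \<bullet> v) - D c u \<bullet> v"
      by (simp add: sum_subtractf inner_D sum_distrib_right)
    finally show ?thesis by (simp add: c0 inner_commute)
  qed
  have inner: "(\<Sum>v\<in>?E. (v \<bullet> D c u)\<^sup>2) = (\<Sum>i\<in>I. (c i)\<^sup>2 * q i u u) - \<Gamma> / (p \<bullet> p) * (u \<bullet> p)\<^sup>2"
    if u: "u \<in> T p" for u
  proof -
    have qpu: "q i p u = \<rho> i * (p \<bullet> u)" if "i \<in> I" for i using u that by (simp add: T_def)
    have "p \<bullet> D c u = (\<Sum>i\<in>I. c i * \<rho> i) * (p \<bullet> u)"
      unfolding inner_commute[of p "D c u"] inner_D sum_distrib_right
      by (rule sum.cong) (simp_all add: qpu q_commute[of _ u])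
    then have 0: "p \<bullet> D c u = 0" by (simp add: c0)
    \<comment> \<open>The normal part of \<open>D c u\<close> is a multiple of \<open>X\<close>,
      with the radial coefficient of \<open>u\<close> as factor.\<close>
    have "N p (D c u) = D (\<lambda>i. c i * ((p \<bullet> u) / (p \<bullet> p))) p"
      unfolding N_def using \<rho>_pos by (intro D_cong) (simp add: 0 q_D_right qpu less_imp_neq[THEN not_sym])
    then have "N p (D c u) \<bullet> D c u = (\<Sum>i\<in>I. c i * ((p \<bullet> u) / (p \<bullet> p)) * (c i * (\<rho> i * (p \<bullet> u))))"
      by (simp add: inner_D q_D_right qpu)
    also have "\<dots> = \<Gamma> / (p \<bullet> p) * (u \<bullet> p)\<^sup>2"
      unfolding \<Gamma>_def sum_divide_distrib sum_distrib_right
      by (rule sum.cong) (simp_all add: power2_eq_square inner_commute)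
    finally show ?thesis
      unfolding tan_frame_sum_inner_squares[OF p]
      by (simp add: inner_D q_D_right power2_eq_square mult.assoc)
  qed
  have "(\<Sum>u\<in>?E. \<Sum>v\<in>?E. (sff M p u v \<bullet> X)\<^sup>2) = (\<Sum>u\<in>?E. \<Sum>v\<in>?E. (v \<bullet> D c u)\<^sup>2)"
    using E(4) by (intro sum.cong) (auto simp: sff_M[OF p] BX)
  also have "\<dots> = (\<Sum>u\<in>?E. (\<Sum>i\<in>I. (c i)\<^sup>2 * q i u u) - \<Gamma> / (p \<bullet> p) * (u \<bullet> p)\<^sup>2)"
    using E(4) inner by (intro sum.cong) auto
  also have "\<dots> = (\<Sum>i\<in>I. (c i)\<^sup>2 * (\<Sum>u\<in>?E. q i u u)) - \<Gamma> / (p \<bullet> p) * (\<Sum>u\<in>?E. (u \<bullet> p)\<^sup>2)"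
    unfolding sum_subtractf sum_distrib_left by (subst sum.swap) simp
  also have "(\<Sum>u\<in>?E. (u \<bullet> p)\<^sup>2) = p \<bullet> p"
    using tan_frame_sum_inner_squares[OF p, of p] N_eq_0[OF self_in_T[OF p]] by simp
  also have "(\<Sum>i\<in>I. (c i)\<^sup>2 * (\<Sum>u\<in>?E. q i u u)) = \<Gamma> * real k"
    unfolding \<Gamma>_def sum_distrib_right
    by (rule sum.cong) (simp_all add: tan_frame_trace_q[OF p] \<rho>_mult[symmetric] algebra_simps)
  finally have "(\<Sum>u\<in>?E. \<Sum>v\<in>?E. (sff M p u v \<bullet> X)\<^sup>2) = (real k - 1) * \<Gamma>"
    using M_D(2)[OF p] by (simp add: algebra_simps)
  then show ?thesis using M_D(2)[OF p] by (simp add: XX)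
qed

text \<open>Both sides are the squared Hilbert-Schmidt norm of \<open>A\<close> restricted to the
  tangent space, compared through the adjoint. The frame on the left may jump from point to point;
  the right side has a form whose continuity in \<open>p\<close> can be proved.\<close>

lemma tan_frame_sum_norm_squares:
  fixes A :: "real ^ 'n \<Rightarrow> real ^ 'n"
  assumes p: "p \<in> M" and A: "linear A"
  shows "(\<Sum>u\<in>tan_frame M p. (norm (A u))\<^sup>2) = (\<Sum>b\<in>Basis. (norm (A (b - N p b)))\<^sup>2)"
proof -
  let ?E = "tan_frame M p"
  have adj: "A x \<bullet> y = x \<bullet> adjoint A y" for x y using adjoint_works[OF A] by (simp add: inner_commute)
  have sq: "(norm x)\<^sup>2 = (\<Sum>b\<in>Basis. (x \<bullet> b)\<^sup>2)" for x :: "real ^ 'n"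
    unfolding power2_norm_eq_inner by (subst euclidean_inner) (simp add: power2_eq_square)
  have "(\<Sum>u\<in>?E. (norm (A u))\<^sup>2) = (\<Sum>b\<in>Basis. \<Sum>u\<in>?E. (u \<bullet> adjoint A b)\<^sup>2)"
    unfolding sq adj by (rule sum.swap)
  also have "\<dots> = (\<Sum>b\<in>Basis. (norm (adjoint A b - N p (adjoint A b)))\<^sup>2)"
  proof (rule sum.cong)
    fix b :: "real ^ 'n"
    show "(\<Sum>u\<in>?E. (u \<bullet> adjoint A b)\<^sup>2) = (norm (adjoint A b - N p (adjoint A b)))\<^sup>2"
      unfolding tan_frame_sum_inner_squares[OF p] power2_norm_eq_inner
      using N_orthogonal_T[OF p diff_N_in_T[OF p], of "adjoint A b" "adjoint A b"]
      by (simp add: inner_diff_left inner_diff_right inner_commute)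
  qed simp
  also have "\<dots> = (\<Sum>b\<in>Basis. \<Sum>b'\<in>Basis. (A (b' - N p b') \<bullet> b)\<^sup>2)"
    unfolding sq adj
    by (intro sum.cong refl)
      (simp add: inner_diff_left inner_diff_right N_self_adjoint[OF p] inner_commute[of _ "adjoint A _"]
        inner_commute[of _ "N p (adjoint A _)"])
  also have "\<dots> = (\<Sum>b\<in>Basis. (norm (A (b - N p b)))\<^sup>2)"
    unfolding sq by (rule sum.swap)
  finally show ?thesis .
qed

end

section \<open>The weighted Hardy inequality and stability\<close>

locale normal_field_on_cone = sphere_product_cone l k ks blk
  for l k :: nat and ks :: "nat \<Rightarrow> nat" and blk :: "'n::finite \<Rightarrow> nat" +
  fixes X :: "real ^ 'n \<Rightarrow> real ^ 'n" and K :: "(real ^ 'n) set"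
  assumes X_C1: "C1_along M X"
    and X_normal: "\<And>p. p \<in> M \<Longrightarrow> X p \<in> normal_space M p"
    and K: "compact K" "K \<subseteq> M"
    and X_0: "\<And>p. p \<in> M - K \<Longrightarrow> X p = 0"
begin

abbreviation DX :: "real ^ 'n \<Rightarrow> real ^ 'n \<Rightarrow> real ^ 'n" where
  "DX p u \<equiv> flat_deriv M X p u"

definition grad_sq :: "real ^ 'n \<Rightarrow> real" where
  "grad_sq p = (\<Sum>u\<in>tan_frame M p. (norm (nproj M p (DX p u)))\<^sup>2)"

lemma X_derivative:
  assumes p: "p \<in> M"
  obtains L where "linear L" "(X has_derivative L) (at p within M)" "\<And>u. u \<in> T p \<Longrightarrow> DX p u = L u"
proof -
  obtain L where L: "(X has_derivative L) (at p within M)"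
    using C1_along_local_extension[OF X_C1 p] p by (metis IntI)
  then show ?thesis
    using that[of L] flat_deriv_eqI[OF L] has_derivative_linear[OF L] by (simp add: tan_space_M[OF p])
qed

lemma continuous_on_X: "continuous_on M X"
  unfolding continuous_on_eq_continuous_within
proof (rule ballI)
  fix p assume "p \<in> M"
  then obtain L where "(X has_derivative L) (at p within M)" by (rule X_derivative)
  then show "continuous (at p within M) X" by (rule has_derivative_continuous)
qed

text \<open>On tangent vectors, where alone it is determined, the derivative along \<open>M\<close>
  equals that of a local extension, and the latter is continuous.\<close>

lemma continuous_on_DX:
  assumes w: "continuous_on M w" "\<And>p. p \<in> M \<Longrightarrow> w p \<in> T p"
  shows "continuous_on M (\<lambda>p. DX p (w p))"
proof (rule continuous_on_locally)
  fix p assume p: "p \<in> M"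
  obtain W Z Z' where W: "open W" "p \<in> W" "continuous_on W Z'"
    and Z: "\<And>x. x \<in> M \<inter> W \<Longrightarrow> (X has_derivative blinfun_apply (Z' x)) (at x within M)"
    using C1_along_local_extension[OF X_C1 p] by metis
  have "continuous_on (M \<inter> W) (\<lambda>x. blinfun_apply (Z' x) (w x))"
    by (intro bounded_bilinear.continuous_on[OF bounded_bilinear_blinfun_apply]
        continuous_on_subset[OF W(3)] continuous_on_subset[OF w(1)]) auto
  moreover have "DX x (w x) = blinfun_apply (Z' x) (w x)" if "x \<in> M \<inter> W" for x
    using flat_deriv_eqI[OF Z[OF that]] w(2) that by (simp add: tan_space_M)
  ultimately have "continuous_on (M \<inter> W) (\<lambda>x. DX x (w x))" by (auto intro: continuous_on_eq)
  then show "\<exists>W. open W \<and> p \<in> W \<and> continuous_on (M \<inter> W) (\<lambda>x. DX x (w x))" using W by blast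
qed

lemma DX_0:
  assumes p: "p \<in> M - K" and u: "u \<in> T p"
  shows "DX p u = 0"
proof -
  have o: "open (- K)" using K by (simp add: compact_imp_closed open_Compl)
  have at: "at p within M \<inter> - K = at p within M" by (rule at_within_nhd[of _ "- K"]) (use p o in auto)
  have "((\<lambda>x. 0) has_derivative (\<lambda>h. 0)) (at p within M \<inter> - K)" by simp
  then have "(X has_derivative (\<lambda>h. 0)) (at p within M \<inter> - K)"
    by (rule has_derivative_transform[rotated 2]) (use p X_0 in auto)
  then show ?thesis using flat_deriv_eqI[of X "\<lambda>h. 0" p M u] u p at by (simp add: tan_space_M)
qed

lemma grad_sq_eq:
  assumes p: "p \<in> M"
  shows "grad_sq p = (\<Sum>b\<in>Basis. (norm (N p (DX p (b - N p b))))\<^sup>2)"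
proof -
  obtain L where L: "linear L" "\<And>u. u \<in> T p \<Longrightarrow> DX p u = L u" using X_derivative[OF p] by metis
  have "grad_sq p = (\<Sum>u\<in>tan_frame M p. (norm ((N p \<circ> L) u))\<^sup>2)"
    unfolding grad_sq_def by (rule sum.cong) (use tan_frame_M(4)[OF p] in \<open>auto simp: nproj_M[OF p] L(2)\<close>)
  also have "\<dots> = (\<Sum>b\<in>Basis. (norm ((N p \<circ> L) (b - N p b)))\<^sup>2)"
    by (rule tan_frame_sum_norm_squares[OF p linear_compose[OF L(1) linear_N]])
  finally show ?thesis using diff_N_in_T[OF p] by (simp add: L(2))
qed

text \<open>The point \<open>p\<close> is itself a tangent vector, since \<open>M\<close> is a
  cone.\<close>

lemma grad_sq_ge_radial:
  assumes p: "p \<in> M"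
  shows "(norm (N p (DX p p)))\<^sup>2 \<le> (p \<bullet> p) * grad_sq p"
proof -
  obtain L where L: "linear L" "\<And>u. u \<in> T p \<Longrightarrow> DX p u = L u" using X_derivative[OF p] by metis
  have "(norm ((N p \<circ> L) p))\<^sup>2 \<le> (p \<bullet> p) * (\<Sum>u\<in>tan_frame M p. (norm ((N p \<circ> L) u))\<^sup>2)"
    using tan_frame_M[OF p] self_in_T[OF p]
    by (intro norm_linear_le_orthonormal linear_compose[OF L(1) linear_N]) auto
  also have "(\<Sum>u\<in>tan_frame M p. (norm ((N p \<circ> L) u))\<^sup>2) = grad_sq p"
    unfolding grad_sq_def by (rule sum.cong) (use tan_frame_M(4)[OF p] in \<open>auto simp: nproj_M[OF p] L(2)\<close>)
  finally show ?thesis using self_in_T[OF p] by (simp add: L(2))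
qed

lemma M_subset: "M \<subseteq> - {0}" by (auto simp: M_def)

lemma continuous_on_norm_powr: "continuous_on M (\<lambda>p. norm p powr a)"
  using M_subset by (intro continuous_intros) auto

lemma continuous_on_grad_sq: "continuous_on M grad_sq"
proof -
  have "continuous_on M (\<lambda>p. \<Sum>b\<in>Basis. (norm (N p (DX p (b - N p b))))\<^sup>2)"
    by (intro continuous_intros continuous_on_N[OF M_subset] continuous_on_DX diff_N_in_T)
  then show ?thesis by (simp add: grad_sq_eq cong: continuous_on_cong)
qed

lemma grad_sq_0: "p \<in> M - K \<Longrightarrow> grad_sq p = 0"
  unfolding grad_sq_def
  by (intro sum.neutral ballI) (use tan_frame_M(4) DX_0 in \<open>simp add: nproj_M linear_0[OF linear_N]\<close>)

text \<open>Integrate \<open>0 \<le> |p|\<^bsup>\<alpha>-2\<^esup> |(D\<^sub>p X)\<^sup>\<bottom> + s X|\<^sup>2\<close> with \<open>s = (k + \<alpha> - 2) / 2\<close>; the mixed term is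
  evaluated by Euler's identity for \<open>|p|\<^bsup>\<alpha>-2\<^esup> |X|\<^sup>2\<close>.\<close>

lemma hardy_inequality:
  shows "((real k + \<alpha> - 2) / 2)\<^sup>2 * (LINT p : M | hausdorff_measure k. norm p powr (\<alpha> - 2) * (X p \<bullet> X p))
    \<le> (LINT p : M | hausdorff_measure k. norm p powr \<alpha> * grad_sq p)"
    and integrable_weighted: "set_integrable (hausdorff_measure k) M (\<lambda>p. norm p powr (\<alpha> - 2) * (X p \<bullet> X p))"
    "set_integrable (hausdorff_measure k) M (\<lambda>p. norm p powr \<alpha> * grad_sq p)"
proof -
  let ?\<mu> = "hausdorff_measure k :: (real ^ 'n) measure"
  define s where "s = (real k + \<alpha> - 2) / 2"
  define g where "g p = norm p powr (\<alpha> - 2) * (X p \<bullet> X p)" for p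
  define h where "h p = norm p powr (\<alpha> - 2) * (X p \<bullet> DX p p)" for p
  have cg: "continuous_on M g" unfolding g_def
    by (intro continuous_intros continuous_on_norm_powr continuous_on_X)
  have ch: "continuous_on M h" unfolding h_def
    by (intro continuous_intros continuous_on_norm_powr continuous_on_X continuous_on_DX self_in_T)
  have cgr: "continuous_on M (\<lambda>p. norm p powr \<alpha> * grad_sq p)"
    by (intro continuous_intros continuous_on_norm_powr continuous_on_grad_sq)
  have g0: "g p = 0" "h p = 0" if "p \<in> M - K" for p using X_0[OF that] by (simp_all add: g_def h_def)
  note int = set_integrable_continuous_compact_support[OF C2_submanifold_M M_borel K]
  have ig: "set_integrable ?\<mu> M g" and ih: "set_integrable ?\<mu> M h"
    and igr: "set_integrable ?\<mu> M (\<lambda>p. norm p powr \<alpha> * grad_sq p)"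
    by (intro int cg ch cgr; simp add: g0 grad_sq_0)+
  show "set_integrable ?\<mu> M (\<lambda>p. norm p powr (\<alpha> - 2) * (X p \<bullet> X p))" using ig by (simp add: g_def[abs_def])
  show "set_integrable ?\<mu> M (\<lambda>p. norm p powr \<alpha> * grad_sq p)" by (rule igr)
  have deriv: "((\<lambda>t. g (t *\<^sub>R p)) has_real_derivative (\<alpha> - 2) * g p + 2 * h p) (at 1)" if p: "p \<in> M" for p
  proof -
    obtain L where L: "(X has_derivative L) (at p within M)" "DX p p = L p"
      by (rule X_derivative[OF p]) (simp add: self_in_T[OF p])
    have dX: "((\<lambda>x. X x \<bullet> X x) has_derivative (\<lambda>u. X p \<bullet> L u + L u \<bullet> X p)) (at p within M)"
      by (rule bounded_bilinear.FDERIV[OF bounded_bilinear_inner L(1) L(1)])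
    have d: "(g has_derivative (\<lambda>u. norm p powr (\<alpha> - 2) * (X p \<bullet> L u + L u \<bullet> X p)
        + ((\<alpha> - 2) * norm p powr (\<alpha> - 2 - 2) * (p \<bullet> u)) * (X p \<bullet> X p))) (at p within M)"
      unfolding g_def[abs_def]
      by (intro has_derivative_mult dX has_derivative_at_withinI[OF has_derivative_norm_powr] M_D(1)[OF p])
    \<comment> \<open>The ray is parametrised by \<open>1 + t\<close> to start at parameter 0, as
      the chain rule along curves requires; a shift restores the derivative at 1.\<close>
    have ray: "(\<lambda>t. (1 + t) *\<^sub>R p) ` {-1<..<1} \<subseteq> M" "(1 + 0) *\<^sub>R p = p"
      "((\<lambda>t. (1 + t) *\<^sub>R p) has_vector_derivative p) (at 0)"
      using M_scaleR[OF p] by (auto simp: has_vector_derivative_def intro!: derivative_eq_intros)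
    have "((\<lambda>t. g ((1 + t) *\<^sub>R p)) has_vector_derivative
        norm p powr (\<alpha> - 2) * (X p \<bullet> L p + L p \<bullet> X p)
        + ((\<alpha> - 2) * norm p powr (\<alpha> - 2 - 2) * (p \<bullet> p)) * (X p \<bullet> X p)) (at 0)"
      by (rule has_derivative_within_curve[OF d zero_less_one ray])
    moreover have "norm p powr (\<alpha> - 2 - 2) * (p \<bullet> p) = norm p powr (\<alpha> - 2)"
      using M_D(1)[OF p] powr_add[of "norm p" "\<alpha> - 2 - 2" 2] by (simp add: power2_norm_eq_inner)
    then have "norm p powr (\<alpha> - 2) * (X p \<bullet> L p + L p \<bullet> X p)
        + ((\<alpha> - 2) * norm p powr (\<alpha> - 2 - 2) * (p \<bullet> p)) * (X p \<bullet> X p) = (\<alpha> - 2) * g p + 2 * h p"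
      unfolding mult.assoc[of "\<alpha> - 2"] by (simp add: g_def h_def L(2) inner_commute)
    ultimately have "((\<lambda>t. g ((1 + t) *\<^sub>R p)) has_real_derivative (\<alpha> - 2) * g p + 2 * h p) (at 0)"
      by (simp add: has_real_derivative_iff_has_vector_derivative)
    then show ?thesis using DERIV_shift[of "\<lambda>t. g (t *\<^sub>R p)" _ 0 1] by (simp add: add.commute)
  qed
  have "(LINT p : M | ?\<mu>. (\<alpha> - 2) * g p + 2 * h p) = - real k * (LINT p : M | ?\<mu>. g p)"
    by (rule euler_identity_on_cone[OF C2_submanifold_M M_borel M_scaleR K cg])
       (use deriv in \<open>auto intro!: continuous_intros cg ch simp: g0\<close>)
  moreover have "(LINT p : M | ?\<mu>. (\<alpha> - 2) * g p + 2 * h p)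
      = (\<alpha> - 2) * (LINT p : M | ?\<mu>. g p) + 2 * (LINT p : M | ?\<mu>. h p)"
    using ig ih by (simp add: set_integral_add)
  \<comment> \<open>Euler's identity solved for the mixed integral is the origin of
    \<open>s\<close>. With another multiplier \<open>t\<close>, the integrated square would yield
    the constant \<open>2 * t * s - t\<^sup>2\<close>, which is largest at
    \<open>t = s\<close>.\<close>
  ultimately have hs: "(LINT p : M | ?\<mu>. h p) = - s * (LINT p : M | ?\<mu>. g p)"
    by (simp add: s_def field_simps)
  have ptw: "- (2 * s) * h p - s\<^sup>2 * g p \<le> norm p powr \<alpha> * grad_sq p" if p: "p \<in> M" for p
  proof -
    let ?n = "N p (DX p p)"
    \<comment> \<open>Pairing with the normal field \<open>X\<close> does not see the tangential
      part of the derivative.\<close>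
    have XN: "X p \<bullet> ?n = X p \<bullet> DX p p"
      using N_self_adjoint[OF p, of "X p" "DX p p"] N_normal[OF p X_normal[OF p]] by simp
    have "0 \<le> (?n + s *\<^sub>R X p) \<bullet> (?n + s *\<^sub>R X p)" by simp
    also have "\<dots> = ?n \<bullet> ?n + 2 * s * (X p \<bullet> DX p p) + s\<^sup>2 * (X p \<bullet> X p)"
      by (simp add: inner_add_left inner_add_right inner_commute[of ?n "X p"] XN power2_eq_square algebra_simps)
    finally have "- (2 * s) * (X p \<bullet> DX p p) - s\<^sup>2 * (X p \<bullet> X p) \<le> (p \<bullet> p) * grad_sq p"
      using grad_sq_ge_radial[OF p] unfolding power2_norm_eq_inner by linarith
    then have "norm p powr (\<alpha> - 2) * (- (2 * s) * (X p \<bullet> DX p p) - s\<^sup>2 * (X p \<bullet> X p))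
        \<le> norm p powr (\<alpha> - 2) * ((p \<bullet> p) * grad_sq p)"
      by (rule mult_left_mono) simp
    also have "\<dots> = norm p powr \<alpha> * grad_sq p"
      using M_D(1)[OF p] by (simp add: powr_diff flip: power2_norm_eq_inner)
    finally show ?thesis by (simp add: g_def h_def algebra_simps)
  qed
  have "s\<^sup>2 * (LINT p : M | ?\<mu>. g p) = (LINT p : M | ?\<mu>. - (2 * s) * h p - s\<^sup>2 * g p)"
  proof -
    have "(LINT p : M | ?\<mu>. - (2 * s) * h p - s\<^sup>2 * g p)
        = (LINT p : M | ?\<mu>. - (2 * s) * h p) - (LINT p : M | ?\<mu>. s\<^sup>2 * g p)"
      by (intro set_integral_diff set_integrable_mult_right ig ih)
    then show ?thesis
      unfolding set_integral_mult_right hs by (simp add: power2_eq_square)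
  qed
  also have "\<dots> \<le> (LINT p : M | ?\<mu>. norm p powr \<alpha> * grad_sq p)"
    by (intro set_integral_mono set_integral_diff set_integrable_mult_right ig ih igr ptw)
  finally show "((real k + \<alpha> - 2) / 2)\<^sup>2 * (LINT p : M | ?\<mu>. norm p powr (\<alpha> - 2) * (X p \<bullet> X p))
    \<le> (LINT p : M | ?\<mu>. norm p powr \<alpha> * grad_sq p)"
    by (simp add: s_def g_def)
qed

end

section \<open>Stationarity and stability of the cone\<close>

context sphere_product_cone begin

text \<open>Both sides vanish: the cone is minimal, and the gradient of a radial function is a
  multiple of the tangent vector \<open>p\<close>.\<close>

lemma f_stationary_M: "f_stationary (\<lambda>x. norm x powr \<alpha>) (UNIV - {0}) M"
  unfolding f_stationary_def
proof
  fix p assume "p \<in> M \<inter> (UNIV - {0})"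
  then have p: "p \<in> M" by simp
  have "N p ((\<alpha> * norm p powr (\<alpha> - 2)) *\<^sub>R p) = 0"
    by (intro N_eq_0 subspace_scale subspace_T self_in_T p)
  then show "norm p powr \<alpha> *\<^sub>R mean_curv M p = nproj M p (grad (\<lambda>x. norm x powr \<alpha>) p)"
    by (simp add: mean_curv_M[OF p] nproj_M[OF p] grad_norm_powr[OF M_D(1)[OF p]])
qed

lemma f_stable_M:
  assumes \<alpha>: "\<alpha> \<ge> - real k + 2 * sqrt (2 * (real k - 1))"
  shows "f_stable k (\<lambda>x. norm x powr \<alpha>) (UNIV - {0}) M"
proof -
  let ?\<mu> = "hausdorff_measure k :: (real ^ 'n) measure"
  let ?f = "\<lambda>x :: real ^ 'n. norm x powr \<alpha>"
  have MU: "M \<inter> (UNIV - {0}) = M" by (auto simp: M_def)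
  have "(LINT p : M | ?\<mu>. ?f p * ((\<Sum>u \<in> tan_frame M p. \<Sum>v \<in> tan_frame M p. (inner (sff M p u v) (X p))\<^sup>2)
                  + (inner (mean_curv M p) (X p))\<^sup>2))
        \<le> (LINT p : M | ?\<mu>.
             ?f p * (\<Sum>u \<in> tan_frame M p. (norm (nproj M p (flat_deriv M X p u)))\<^sup>2)
             + hess ?f p (X p) (X p))"
    if X: "normal_field_cs M X" for X
  proof -
    obtain K where "compact K" "K \<subseteq> M" "\<forall>p \<in> M - K. X p = 0" using X unfolding normal_field_cs_def by blast
    then interpret normal_field_on_cone l k ks blk X K
      using X by unfold_locales (auto simp: normal_field_cs_def)
    define G where "G = (LINT p : M | ?\<mu>. norm p powr (\<alpha> - 2) * (X p \<bullet> X p))"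
    have G0: "0 \<le> G" unfolding G_def set_lebesgue_integral_def
      by (intro Bochner_Integration.integral_nonneg) simp
    have "(LINT p : M | ?\<mu>. ?f p * ((\<Sum>u \<in> tan_frame M p. \<Sum>v \<in> tan_frame M p. (inner (sff M p u v) (X p))\<^sup>2)
                  + (inner (mean_curv M p) (X p))\<^sup>2))
        = (LINT p : M | ?\<mu>. (real k - 1) * (norm p powr (\<alpha> - 2) * (X p \<bullet> X p)))"
    proof (rule set_lebesgue_integral_cong)
      show "\<forall>p. p \<in> M \<longrightarrow> ?f p * ((\<Sum>u \<in> tan_frame M p. \<Sum>v \<in> tan_frame M p. (inner (sff M p u v) (X p))\<^sup>2)
                  + (inner (mean_curv M p) (X p))\<^sup>2) = (real k - 1) * (norm p powr (\<alpha> - 2) * (X p \<bullet> X p))"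
      proof (intro allI impI)
        fix p assume p: "p \<in> M"
        then show "?f p * ((\<Sum>u \<in> tan_frame M p. \<Sum>v \<in> tan_frame M p. (inner (sff M p u v) (X p))\<^sup>2)
                  + (inner (mean_curv M p) (X p))\<^sup>2) = (real k - 1) * (norm p powr (\<alpha> - 2) * (X p \<bullet> X p))"
          using M_D(1)[OF p]
          by (simp add: sum_sff_squares[OF p X_normal[OF p]] mean_curv_M powr_diff flip: power2_norm_eq_inner[of p])
      qed
    qed (simp add: M_borel)
    also have "\<dots> = (real k - 1) * G" by (simp add: G_def)
    also have "\<dots> \<le> (((real k + \<alpha> - 2) / 2)\<^sup>2 + \<alpha>) * G"
    proof (rule mult_right_mono[OF _ G0])
      \<comment> \<open>Four times the difference of the two sides of the goal is
        \<open>(k + \<alpha>)^2 - 8 * (k - 1)\<close>. The hypothesis may be squared because its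
        lower bound for \<open>k + \<alpha>\<close> is nonnegative.\<close>
      have "(2 * sqrt (2 * (real k - 1)))\<^sup>2 \<le> (real k + \<alpha>)\<^sup>2"
        using \<alpha> sum_ks(2) by (intro power_mono) auto
      then show "real k - 1 \<le> ((real k + \<alpha> - 2) / 2)\<^sup>2 + \<alpha>"
        using sum_ks(2) by (simp add: power_mult_distrib power2_eq_square field_simps)
    qed
    also have "\<dots> \<le> (LINT p : M | ?\<mu>. ?f p * grad_sq p) + \<alpha> * G"
      using hardy_inequality[of \<alpha>] by (simp add: G_def algebra_simps)
    also have "\<dots> = (LINT p : M | ?\<mu>. ?f p * grad_sq p + \<alpha> * (norm p powr (\<alpha> - 2) * (X p \<bullet> X p)))"
      using integrable_weighted[of \<alpha>] by (simp add: set_integral_add G_def)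
    also have "\<dots> = (LINT p : M | ?\<mu>.
             ?f p * (\<Sum>u \<in> tan_frame M p. (norm (nproj M p (flat_deriv M X p u)))\<^sup>2)
             + hess ?f p (X p) (X p))"
    proof (rule set_lebesgue_integral_cong)
      show "\<forall>p. p \<in> M \<longrightarrow> ?f p * grad_sq p + \<alpha> * (norm p powr (\<alpha> - 2) * (X p \<bullet> X p))
        = ?f p * (\<Sum>u \<in> tan_frame M p. (norm (nproj M p (flat_deriv M X p u)))\<^sup>2) + hess ?f p (X p) (X p)"
      proof (intro allI impI)
        fix p assume p: "p \<in> M"
        have "p \<bullet> X p = 0" using X_normal[OF p] self_in_T[OF p] by (simp add: normal_space_def tan_space_M[OF p])
        then show "?f p * grad_sq p + \<alpha> * (norm p powr (\<alpha> - 2) * (X p \<bullet> X p))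
          = ?f p * (\<Sum>u \<in> tan_frame M p. (norm (nproj M p (flat_deriv M X p u)))\<^sup>2) + hess ?f p (X p) (X p)"
          using M_D(1)[OF p] by (simp add: grad_sq_def hess_norm_powr_orthogonal)
      qed
    qed (simp add: M_borel)
    finally show ?thesis .
  qed
  then show ?thesis
    unfolding f_stable_def MU using C2_submanifold_M f_stationary_M by blast
qed

end

theorem corollary1p7:
  fixes l k :: nat
    and ks :: "nat \<Rightarrow> nat"
    and blk :: "'n::finite \<Rightarrow> nat"
    and \<alpha> :: real
    and C :: "(real ^ 'n) set"
  assumes "2 \<le> l"
    and "\<forall>i\<in>{1..l}. 1 \<le> ks i"
    and "\<forall>a. blk a \<in> {1..l}"
    and "\<forall>i\<in>{1..l}. card {a. blk a = i} = ks i + 1"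
    and "k = 1 + (\<Sum>i=1..l. ks i)"
    and "C = cone_over (sphere_product l blk (minimal_radius l ks))"
  shows "(\<alpha> \<ge> - real k + 2 * sqrt (2 * (real k - 1)) \<longrightarrow>
            f_stable k (\<lambda>x. norm x powr \<alpha>) (UNIV - {0}) (C - {0})) \<and>
         (k \<ge> 7 \<and> \<alpha> \<ge> 4 * sqrt 3 - 7 \<longrightarrow>
            f_stable k (\<lambda>x. norm x powr \<alpha>) (UNIV - {0}) (C - {0}))"
proof -
  interpret sphere_product_cone l k ks blk using assms(1-5) by unfold_locales blast+
  have C: "C - {0} = M" unfolding assms(6) by (rule M_eq_cone)
  \<comment> \<open>At \<open>k = 7\<close> there is equality, as
    \<open>2 * sqrt 12 = 4 * sqrt 3\<close>. For larger \<open>k\<close>, put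
    \<open>y = k - 7\<close>; after squaring, the claim is
    \<open>8 * (y + 6) \<le> (y + 4 * sqrt 3)^2\<close>, where the constants 48 cancel and
    \<open>sqrt 3 \<ge> 1\<close> handles the linear terms.\<close>
  have "4 * sqrt 3 - 7 \<ge> - real k + 2 * sqrt (2 * (real k - 1))" if "7 \<le> k"
  proof -
    define y where "y = real k - 7"
    have y: "0 \<le> y" "real k = y + 7" using that by (simp_all add: y_def)
    define z where "z = sqrt 3 * y"
    have "1 * y \<le> z" unfolding z_def using y(1) by (intro mult_right_mono) auto
    then have "8 * y \<le> y\<^sup>2 + 8 * z" using zero_le_power2[of y] by linarith
    then have "8 * (y + 6) \<le> y\<^sup>2 + 8 * z + 48" by (simp add: distrib_left)
    also have "\<dots> = (y + 4 * sqrt 3)\<^sup>2"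
      by (simp add: z_def power2_eq_square algebra_simps)
    finally have "8 * (y + 6) \<le> (y + 4 * sqrt 3)\<^sup>2" .
    then have "(2 * sqrt (2 * (real k - 1)))\<^sup>2 \<le> (y + 4 * sqrt 3)\<^sup>2"
      using y by (simp add: power_mult_distrib)
    then have "2 * sqrt (2 * (real k - 1)) \<le> y + 4 * sqrt 3"
      by (rule power2_le_imp_le) (use y in simp)
    then show ?thesis using y(2) by linarith
  qed
  then show ?thesis unfolding C using f_stable_M by fastforce
qed

end
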